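(* Suppose that one of the following two sets of data is given: (i) $C^7$-functions $(\bar w_-(r),\bar q_-(r))$ with $\bar w_-(0)=0$ and $\bar q_-(r)>0$, together with boundary values $\overline M_-(0)$ and $\bar p_-(0)$ on the symmetry axis with $\overline M_-(0)>1$ and $\bar p_-(0)>0$; or (ii) $C^7$-functions $(\bar p_-(r),\bar s_-(r))$ with $\bar p_-(0)>0$, together with a boundary value $\bar q_-(0)>0$ on the symmetry axis with $\overline M_-(0)>1$. Then there exists a unique special piecewise $C^7$ shock solution $(\overline U_-(r);\overline U_+(r);\overline\varphi(r))$ in $\Omega$ with the given data, of the form $$\overline U_\pm(r)=(\bar p_\pm(r),0,\bar w_\pm(r),\bar q_\pm(r),\bar s_\pm(r))^\top,$$ satisfying $$\partial_r\bar p_-=\frac1r\bar\rho_-\bar w_-^2,\qquad \partial_r\bar p_+=\frac1r\bar\rho_+\bar w_+^2$$ and the Rankine–Hugoniot conditions $$\bar p_+=\big((1+\mu^2)\overline M_-^2-\mu^2\big)\bar p_-,\quad \bar q_+=\mu^2\Big(\bar q_-+\frac{2}{\gamma-1}\frac{\bar c_-^2}{\bar q_-}\Big),\quad \bar\rho_+=\frac{\bar\rho_-\bar q_-}{\bar q_+},\quad \bar w_+=\bar w_-,$$ up to an arbitrary shift of the shock front location, that is, $z=\overline\varphi(r)\equiv\bar z_s$ is the location of the shock front for an arbitrary constant $\bar z_s\in(0,L)$.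
   Context: Constants: $\gamma>1$, $A>0$, $c_v>0$, $L>0$, $r_0>0$, $\mu^2=\frac{\gamma-1}{\gamma+1}$. $\Omega=\{(z,r):0<z<L,\ 0\le r<r_0\}$. A state is $U=(p,\theta,w,q,s)^\top$: pressure, flow angle, swirl velocity, speed modulo swirl, entropy. The density $\rho$ is determined by $p=Ae^{s/c_v}\rho^\gamma$. Notation: $\bar c_-^2=\gamma\bar p_-/\bar\rho_-$, $\overline M_-^2=\bar q_-^2/\bar c_-^2$. A special shock solution is one in which the states depend only on $r$, equal to $\overline U_-(r)$ for $0<z<\bar z_s$ and $\overline U_+(r)$ for $\bar z_s<z<L$, with $\overline U_\pm$ of class $C^7$.
   Formalization: In (ii) it is assumed that some C^7 function w satisfies p_-' = rho_- w^2/r (necessary for existence), and uniqueness is up to the sign of the swirl at each r, the same on both sides, since the data fix only w^2. A shock has p_- < p_+, which follows from M_-(0)>1. *)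

theory Defs
  imports "HOL-Analysis.Analysis"
begin

text \<open>
  \<open>C_k_on k f S\<close>: \<open>f\<close> is of class \<open>C\<^sup>k\<close> on \<open>S\<close>; \<open>D i\<close> is the \<open>i\<close>-th derivative.
  Derivatives are taken within \<open>S\<close>, so on \<open>{0..<r0}\<close> they are one-sided at the axis
  \<open>r = 0\<close>, and the values of \<open>f\<close> outside \<open>S\<close> are irrelevant.
\<close>

definition C_k_on :: "nat \<Rightarrow> (real \<Rightarrow> real) \<Rightarrow> real set \<Rightarrow> bool" where
  "C_k_on k f S \<longleftrightarrow>
     (\<exists>D :: nat \<Rightarrow> real \<Rightarrow> real.
        (\<forall>x\<in>S. D 0 x = f x) \<and>
        (\<forall>i<k. \<forall>x\<in>S. (D i has_real_derivative D (Suc i) x) (at x within S)) \<and>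
        continuous_on S (D k))"

text \<open>The state \<open>(p, \<theta>, w, q, s)\<close>.\<close>

record flow_state =
  pressure :: real
  angle :: real
  swirl :: real
  speed :: real      \<comment> \<open>speed modulo swirl\<close>
  entropy :: real

text \<open>The polytropic equation of state, solved for the density; meaningful for \<open>p > 0\<close>.\<close>

definition gas_density :: "real \<Rightarrow> real \<Rightarrow> real \<Rightarrow> real \<Rightarrow> real \<Rightarrow> real" where
  "gas_density \<gamma> A cv p s = (THE \<rho>. 0 < \<rho> \<and> p = A * exp (s / cv) * \<rho> powr \<gamma>)"

lemma gas_density_explicit:
  assumes "\<gamma> > 1" "A > 0" "p > 0"
  shows "gas_density \<gamma> A cv p s = (p / (A * exp (s / cv))) powr (1 / \<gamma>)"
  unfolding gas_density_def
proof (rule the_equality)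
  show "0 < (p / (A * exp (s / cv))) powr (1 / \<gamma>) \<and>
        p = A * exp (s / cv) * ((p / (A * exp (s / cv))) powr (1 / \<gamma>)) powr \<gamma>"
    using assms by (simp add: powr_powr)
next
  fix \<rho> assume \<rho>: "0 < \<rho> \<and> p = A * exp (s / cv) * \<rho> powr \<gamma>"
  then have "p / (A * exp (s / cv)) = \<rho> powr \<gamma>"
    using assms by (simp add: field_simps)
  then show "\<rho> = (p / (A * exp (s / cv))) powr (1 / \<gamma>)"
    using \<rho> assms by (simp add: powr_powr)
qed

definition \<rho>_of :: "real \<Rightarrow> real \<Rightarrow> real \<Rightarrow> flow_state \<Rightarrow> real" where
  "\<rho>_of \<gamma> A cv U = gas_density \<gamma> A cv (pressure U) (entropy U)"

definition sound_speed_sq :: "real \<Rightarrow> real \<Rightarrow> real \<Rightarrow> flow_state \<Rightarrow> real" where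
  "sound_speed_sq \<gamma> A cv U = \<gamma> * pressure U / \<rho>_of \<gamma> A cv U"

definition mach_sq :: "real \<Rightarrow> real \<Rightarrow> real \<Rightarrow> flow_state \<Rightarrow> real" where
  "mach_sq \<gamma> A cv U = (speed U)\<^sup>2 / sound_speed_sq \<gamma> A cv U"

definition mu_sq :: "real \<Rightarrow> real" where
  "mu_sq \<gamma> = (\<gamma> - 1) / (\<gamma> + 1)"

text \<open>
  A profile of the form \<open>(p(r), 0, w(r), q(r), s(r))\<close> of class \<open>C\<^sup>7\<close>. Positivity of \<open>p\<close>
  is what makes the density well defined, and \<open>q\<close>, being a speed that is divided by in
  the jump conditions, is positive.
\<close>

definition swirl_profile :: "real \<Rightarrow> (real \<Rightarrow> flow_state) \<Rightarrow> bool" where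
  "swirl_profile r0 U \<longleftrightarrow>
     C_k_on 7 (\<lambda>r. pressure (U r)) {0..<r0} \<and>
     C_k_on 7 (\<lambda>r. swirl (U r)) {0..<r0} \<and>
     C_k_on 7 (\<lambda>r. speed (U r)) {0..<r0} \<and>
     C_k_on 7 (\<lambda>r. entropy (U r)) {0..<r0} \<and>
     (\<forall>r\<in>{0..<r0}. angle (U r) = 0 \<and> pressure (U r) > 0 \<and> speed (U r) > 0)"

text \<open>
  The radial momentum equation, to which the steady axisymmetric Euler equations reduce
  for states with \<open>\<theta> = 0\<close> that depend on \<open>r\<close> only. Because of the factor \<open>1 / r\<close> it is
  imposed off the axis.
\<close>

definition radial_balance ::
    "real \<Rightarrow> real \<Rightarrow> real \<Rightarrow> real \<Rightarrow> (real \<Rightarrow> real) \<Rightarrow> (real \<Rightarrow> real) \<Rightarrow> (real \<Rightarrow> real) \<Rightarrow> bool" where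
  "radial_balance \<gamma> A cv r0 p w s \<longleftrightarrow>
     (\<forall>r\<in>{0<..<r0}.
        (p has_real_derivative (1 / r * gas_density \<gamma> A cv (p r) (s r) * (w r)\<^sup>2)) (at r))"

definition rankine_hugoniot ::
    "real \<Rightarrow> real \<Rightarrow> real \<Rightarrow> flow_state \<Rightarrow> flow_state \<Rightarrow> bool" where
  "rankine_hugoniot \<gamma> A cv Um Up \<longleftrightarrow>
     pressure Up = ((1 + mu_sq \<gamma>) * mach_sq \<gamma> A cv Um - mu_sq \<gamma>) * pressure Um \<and>
     speed Up = mu_sq \<gamma> * (speed Um + 2 / (\<gamma> - 1) * (sound_speed_sq \<gamma> A cv Um / speed Um)) \<and>
     \<rho>_of \<gamma> A cv Up = \<rho>_of \<gamma> A cv Um * speed Um / speed Up \<and>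
     swirl Up = swirl Um"

text \<open>
  The triple \<open>(Um; Up; \<phi>)\<close> stands for the flow in \<open>{(z, r). 0 < z < L \<and> 0 \<le> r < r0}\<close> that
  equals \<open>Um r\<close> ahead of the planar front \<open>z = \<phi> r = zs\<close> and \<open>Up r\<close> behind it. The inequality
  between the pressures is the entropy condition, which rules out a degenerate front
  without a jump.
\<close>

definition special_shock_solution ::
    "real \<Rightarrow> real \<Rightarrow> real \<Rightarrow> real \<Rightarrow> real \<Rightarrow>
     (real \<Rightarrow> flow_state) \<Rightarrow> (real \<Rightarrow> flow_state) \<Rightarrow> (real \<Rightarrow> real) \<Rightarrow> bool" where
  "special_shock_solution \<gamma> A cv L r0 Um Up \<phi> \<longleftrightarrow>
     swirl_profile r0 Um \<and>
     swirl_profile r0 Up \<and>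
     radial_balance \<gamma> A cv r0 (\<lambda>r. pressure (Um r)) (\<lambda>r. swirl (Um r)) (\<lambda>r. entropy (Um r)) \<and>
     radial_balance \<gamma> A cv r0 (\<lambda>r. pressure (Up r)) (\<lambda>r. swirl (Up r)) (\<lambda>r. entropy (Up r)) \<and>
     (\<exists>zs\<in>{0<..<L}. \<forall>r\<in>{0..<r0}. \<phi> r = zs) \<and>
     (\<forall>r\<in>{0..<r0}. rankine_hugoniot \<gamma> A cv (Um r) (Up r) \<and> pressure (Um r) < pressure (Up r))"

definition data_swirl_speed ::
    "real \<Rightarrow> real \<Rightarrow> real \<Rightarrow> real \<Rightarrow> (real \<Rightarrow> real) \<Rightarrow> (real \<Rightarrow> real) \<Rightarrow> real \<Rightarrow> real \<Rightarrow>
     (real \<Rightarrow> flow_state) \<Rightarrow> bool" where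
  "data_swirl_speed \<gamma> A cv r0 w q M0 p0 Um \<longleftrightarrow>
     (\<forall>r\<in>{0..<r0}. swirl (Um r) = w r \<and> speed (Um r) = q r) \<and>
     mach_sq \<gamma> A cv (Um 0) = M0\<^sup>2 \<and> pressure (Um 0) = p0"

definition data_pressure_entropy ::
    "real \<Rightarrow> (real \<Rightarrow> real) \<Rightarrow> (real \<Rightarrow> real) \<Rightarrow> real \<Rightarrow> (real \<Rightarrow> flow_state) \<Rightarrow> bool" where
  "data_pressure_entropy r0 p s q0 Um \<longleftrightarrow>
     (\<forall>r\<in>{0..<r0}. pressure (Um r) = p r \<and> entropy (Um r) = s r) \<and>
     speed (Um 0) = q0"

text \<open>
  Prescribed pressure and entropy enter the equations through \<open>w\<^sup>2 = r \<cdot> p' / \<rho>\<close> only. So they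
  are attained by a flow exactly when this expression is the square of a \<open>C\<^sup>7\<close> function (in
  particular \<open>p' \<ge> 0\<close>), and they do not determine the sense of rotation.
\<close>

definition swirl_compatible ::
    "real \<Rightarrow> real \<Rightarrow> real \<Rightarrow> real \<Rightarrow> (real \<Rightarrow> real) \<Rightarrow> (real \<Rightarrow> real) \<Rightarrow> bool" where
  "swirl_compatible \<gamma> A cv r0 p s \<longleftrightarrow>
     (\<exists>w. C_k_on 7 w {0..<r0} \<and> radial_balance \<gamma> A cv r0 p w s)"

definition reverse_swirl :: "flow_state \<Rightarrow> flow_state" where
  "reverse_swirl U = U\<lparr>swirl := - swirl U\<rparr>"

end

theory Submission
  imports Defs
begin

text \<open>
  Write \<open>m\<close> for the squared Mach number ahead of the front. Given the state ahead, with
  \<open>m > 1\<close>, the jump conditions determine the state behind, the entropy being recovered from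
  pressure and density (\<open>rankine_hugoniot_unique\<close>); and \<open>m > 1\<close> is the same as a rise
  of the pressure (\<open>pressure_rises_iff\<close>). The swirl velocity is continuous, so behind the
  front the radial balance reads \<open>p\<^sub>+' = \<kappa>(m) p'\<close>, where \<open>\<kappa>(m)\<close> is the
  ratio of the densities and \<open>p\<^sub>+ = ((1 + \<mu>\<^sup>2) m - \<mu>\<^sup>2) p\<close>. Once the balance
  ahead holds, the balance behind is therefore equivalent to a scalar equation
  \<open>m' = - F(m) p' / p\<close> with an explicit rational \<open>F\<close> that vanishes at \<open>m = 1\<close> and is
  positive for \<open>m > 1\<close> (\<open>mach_rate_of_balances\<close>, \<open>balance_behind_front\<close>).

  If pressure and entropy are given, this equation says that \<open>N(m) + ln p\<close> is constant for an
  explicit \<open>N\<close> with \<open>N' = 1 / F\<close>, an increasing bijection from \<open>(1, \<infinity>)\<close> onto the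
  reals. Thus \<open>m\<close>, and with it the speed, exists on the whole interval, is unique and stays
  above \<open>1\<close>; the differential equation itself lifts its regularity to \<open>C\<^sup>7\<close>. The balance
  equation gives only the square of the swirl, whence the two senses of rotation.

  If swirl and speed are given, then \<open>\<rho> = \<gamma> p m / q\<^sup>2\<close> turns the balance into
  \<open>(ln p)' = \<gamma> m h\<close> with \<open>h = w\<^sup>2 / (r q\<^sup>2)\<close>, and the equation for \<open>m\<close> becomes
  autonomous up to the factor \<open>h\<close>: \<open>m' = - \<gamma> m F(m) h\<close>. In terms of \<open>x = 1 / m\<close> its
  integral is \<open>(1 - x) (\<gamma> + x) = K\<^sub>0 exp (- (\<gamma> - 1) \<integral>h)\<close>, a quadratic equation for
  \<open>x\<close> whose right-hand side stays in \<open>(0, \<gamma>)\<close>, so that \<open>0 < x < 1\<close> throughout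
  (\<open>mach_ode_given_swirl\<close>). At the axis \<open>w(0) = 0\<close> makes \<open>w / r\<close> of class \<open>C\<^sup>6\<close>
  (\<open>C_k_on_factor_axis\<close>); hence \<open>h\<close> is \<open>C\<^sup>6\<close> and both \<open>m\<close> and \<open>p\<close> are \<open>C\<^sup>7\<close>.
\<close>

section \<open>Calculus of functions of class \<open>C\<^sup>k\<close>\<close>

lemma C_k_on_cong:
  assumes "\<And>x. x \<in> S \<Longrightarrow> f x = g x"
  shows "C_k_on k f S \<longleftrightarrow> C_k_on k g S"
  unfolding C_k_on_def using assms by auto

lemma C_k_on_0: "C_k_on 0 f S \<longleftrightarrow> continuous_on S f"
proof
  assume "C_k_on 0 f S"
  then obtain D :: "nat \<Rightarrow> real \<Rightarrow> real" where "\<forall>x\<in>S. D 0 x = f x" "continuous_on S (D 0)"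
    unfolding C_k_on_def by blast
  then show "continuous_on S f"
    using continuous_on_eq by blast
next
  assume "continuous_on S f"
  then show "C_k_on 0 f S"
    unfolding C_k_on_def by (intro exI[of _ "\<lambda>i. f"]) simp
qed

lemma C_k_on_Suc:
  "C_k_on (Suc k) f S \<longleftrightarrow>
     (\<exists>g. (\<forall>x\<in>S. (f has_real_derivative g x) (at x within S)) \<and> C_k_on k g S)"
proof
  assume "C_k_on (Suc k) f S"
  then obtain D where D: "\<And>x. x \<in> S \<Longrightarrow> D 0 x = f x"
    "\<And>i x. i < Suc k \<Longrightarrow> x \<in> S \<Longrightarrow> (D i has_real_derivative D (Suc i) x) (at x within S)"
    "continuous_on S (D (Suc k))"
    unfolding C_k_on_def by blast
  have "(f has_real_derivative D (Suc 0) x) (at x within S)" if "x \<in> S" for x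
    using D(2)[of 0 x] that D(1) has_field_derivative_transform_within[of "D 0" "D (Suc 0) x" x S 1 f]
    by simp
  moreover have "C_k_on k (D (Suc 0)) S"
    unfolding C_k_on_def using D by (intro exI[of _ "\<lambda>i. D (Suc i)"]) auto
  ultimately show "\<exists>g. (\<forall>x\<in>S. (f has_real_derivative g x) (at x within S)) \<and> C_k_on k g S"
    by blast
next
  assume "\<exists>g. (\<forall>x\<in>S. (f has_real_derivative g x) (at x within S)) \<and> C_k_on k g S"
  then obtain g D where g: "\<And>x. x \<in> S \<Longrightarrow> (f has_real_derivative g x) (at x within S)"
    and D: "\<And>x. x \<in> S \<Longrightarrow> D 0 x = g x"
    "\<And>i x. i < k \<Longrightarrow> x \<in> S \<Longrightarrow> (D i has_real_derivative D (Suc i) x) (at x within S)"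
    "continuous_on S (D k)"
    unfolding C_k_on_def by blast
  show "C_k_on (Suc k) f S"
    unfolding C_k_on_def
    using g D by (intro exI[of _ "\<lambda>i. case i of 0 \<Rightarrow> f | Suc j \<Rightarrow> D j"]) (auto split: nat.splits)
qed

lemma C_k_on_SucI:
  assumes "\<And>x. x \<in> S \<Longrightarrow> (f has_real_derivative g x) (at x within S)" "C_k_on k g S"
  shows "C_k_on (Suc k) f S"
  using assms C_k_on_Suc by blast

lemma C_k_on_SucD:
  assumes "C_k_on (Suc k) f S"
  shows "C_k_on k f S"
  using assms
proof (induction k arbitrary: f)
  case 0
  then show ?case
    unfolding C_k_on_0 C_k_on_Suc using DERIV_continuous_on by blast
next
  case (Suc k)
  then obtain g where "\<forall>x\<in>S. (f has_real_derivative g x) (at x within S)" "C_k_on (Suc k) g S"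
    using C_k_on_Suc[of "Suc k"] by blast
  then show ?case
    using C_k_on_SucI Suc.IH by blast
qed

lemma C_k_on_le:
  assumes "C_k_on k f S" "j \<le> k"
  shows "C_k_on j f S"
  using assms(2,1) by (induction rule: inc_induct) (auto dest: C_k_on_SucD)

lemma C_k_on_continuous: "C_k_on k f S \<Longrightarrow> continuous_on S f"
  by (induction k) (simp_all add: C_k_on_0 C_k_on_SucD)

lemma C_k_on_const: "C_k_on k (\<lambda>x. c) S"
proof -
  have "C_k_on k (\<lambda>x. 0) S" for k
    by (induction k) (auto simp: C_k_on_0 intro!: C_k_on_SucI[where g = "\<lambda>x. 0"])
  then show ?thesis
    by (cases k) (auto simp: C_k_on_0 intro!: C_k_on_SucI[where g = "\<lambda>x. 0"])
qed

lemma C_k_on_add: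
  assumes "C_k_on k f S" "C_k_on k g S"
  shows "C_k_on k (\<lambda>x. f x + g x) S"
  using assms
proof (induction k arbitrary: f g)
  case 0
  then show ?case by (simp add: C_k_on_0 continuous_on_add)
next
  case (Suc k)
  then obtain f' g' where
    "\<And>x. x \<in> S \<Longrightarrow> (f has_real_derivative f' x) (at x within S)" "C_k_on k f' S"
    "\<And>x. x \<in> S \<Longrightarrow> (g has_real_derivative g' x) (at x within S)" "C_k_on k g' S"
    unfolding C_k_on_Suc by blast
  then show ?case
    by (intro C_k_on_SucI[where g = "\<lambda>x. f' x + g' x"] Suc.IH) (auto intro: DERIV_add)
qed

lemma C_k_on_mult:
  assumes "C_k_on k f S" "C_k_on k g S"
  shows "C_k_on k (\<lambda>x. f x * g x) S"
  using assms
proof (induction k arbitrary: f g)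
  case 0
  then show ?case by (simp add: C_k_on_0 continuous_on_mult)
next
  case (Suc k)
  then obtain f' g' where
    "\<And>x. x \<in> S \<Longrightarrow> (f has_real_derivative f' x) (at x within S)" "C_k_on k f' S"
    "\<And>x. x \<in> S \<Longrightarrow> (g has_real_derivative g' x) (at x within S)" "C_k_on k g' S"
    unfolding C_k_on_Suc by blast
  with Suc.prems show ?case
    by (intro C_k_on_SucI[where g = "\<lambda>x. f' x * g x + g' x * f x"] C_k_on_add Suc.IH)
      (auto intro: DERIV_mult C_k_on_SucD)
qed

lemma C_k_on_diff:
  assumes "C_k_on k f S" "C_k_on k g S"
  shows "C_k_on k (\<lambda>x. f x - g x) S"
  using C_k_on_add[OF assms(1) C_k_on_mult[OF C_k_on_const[where c = "-1"] assms(2)]] by simp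

lemma C_k_on_power:
  assumes "C_k_on k f S"
  shows "C_k_on k (\<lambda>x. f x ^ n) S"
  by (induction n) (auto intro: C_k_on_const C_k_on_mult assms)

lemma C_k_on_inverse:
  assumes "C_k_on k f S" "\<And>x. x \<in> S \<Longrightarrow> f x \<noteq> 0"
  shows "C_k_on k (\<lambda>x. inverse (f x)) S"
  using assms(1)
proof (induction k)
  case 0
  then show ?case using assms(2) by (simp add: C_k_on_0 continuous_on_inverse)
next
  case (Suc k)
  then obtain f' where
    f': "\<And>x. x \<in> S \<Longrightarrow> (f has_real_derivative f' x) (at x within S)" "C_k_on k f' S"
    unfolding C_k_on_Suc by blast
  have IH: "C_k_on k (\<lambda>x. inverse (f x)) S"
    using Suc C_k_on_SucD by blast
  show ?case
  proof (rule C_k_on_SucI)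
    show "((\<lambda>x. inverse (f x)) has_real_derivative
        ((-1) * (inverse (f x) * f' x * inverse (f x)))) (at x within S)" if "x \<in> S" for x
      using DERIV_inverse'[OF f'(1)[OF that] assms(2)[OF that]] by simp
  qed (intro C_k_on_mult C_k_on_const IH f'(2))
qed

lemma C_k_on_divide:
  assumes "C_k_on k f S" "C_k_on k g S" "\<And>x. x \<in> S \<Longrightarrow> g x \<noteq> 0"
  shows "C_k_on k (\<lambda>x. f x / g x) S"
  using C_k_on_mult[OF assms(1) C_k_on_inverse[OF assms(2,3)]] by (simp add: divide_inverse)

lemma C_k_on_exp:
  assumes "C_k_on k f S"
  shows "C_k_on k (\<lambda>x. exp (f x)) S"
  using assms
proof (induction k)
  case 0
  then show ?case by (simp add: C_k_on_0 continuous_on_exp)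
next
  case (Suc k)
  then obtain f' where
    f': "\<And>x. x \<in> S \<Longrightarrow> (f has_real_derivative f' x) (at x within S)" "C_k_on k f' S"
    unfolding C_k_on_Suc by blast
  have IH: "C_k_on k (\<lambda>x. exp (f x)) S"
    using Suc C_k_on_SucD by blast
  show ?case
    by (rule C_k_on_SucI[where g = "\<lambda>x. exp (f x) * f' x"])
      (auto intro!: derivative_eq_intros f' C_k_on_mult IH)
qed

lemma C_k_on_ln:
  assumes "C_k_on k f S" "\<And>x. x \<in> S \<Longrightarrow> f x > 0"
  shows "C_k_on k (\<lambda>x. ln (f x)) S"
proof (cases k)
  case 0
  have "\<forall>x\<in>S. f x \<noteq> 0"
    using assms(2) by force
  with 0 show ?thesis
    using assms(1) by (simp add: C_k_on_0 continuous_on_ln)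
next
  case (Suc j)
  then obtain f' where
    f': "\<And>x. x \<in> S \<Longrightarrow> (f has_real_derivative f' x) (at x within S)" "C_k_on j f' S"
    using assms(1) unfolding Suc C_k_on_Suc by blast
  have nz: "f x \<noteq> 0" if "x \<in> S" for x
    using assms(2)[OF that] by simp
  show ?thesis
    unfolding Suc
  proof (rule C_k_on_SucI)
    show "((\<lambda>x. ln (f x)) has_real_derivative f' x / f x) (at x within S)" if "x \<in> S" for x
      using f'(1)[OF that] assms(2)[OF that]
      by (auto intro!: derivative_eq_intros)
    show "C_k_on j (\<lambda>x. f' x / f x) S"
      using assms(1) Suc C_k_on_SucD nz f'(2) by (intro C_k_on_divide) auto
  qed
qed

lemma C_k_on_powr:
  assumes "C_k_on k f S" "\<And>x. x \<in> S \<Longrightarrow> f x > 0"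
  shows "C_k_on k (\<lambda>x. f x powr a) S"
proof -
  have "C_k_on k (\<lambda>x. exp (a * ln (f x))) S"
    by (intro C_k_on_exp C_k_on_mult C_k_on_const C_k_on_ln assms)
  moreover have "exp (a * ln (f x)) = f x powr a" if "x \<in> S" for x
    using assms(2)[OF that] by (simp add: powr_def)
  ultimately show ?thesis
    using C_k_on_cong[of S "\<lambda>x. exp (a * ln (f x))" "\<lambda>x. f x powr a"] by blast
qed

lemma C_k_on_sqrt:
  assumes "C_k_on k f S" "\<And>x. x \<in> S \<Longrightarrow> f x > 0"
  shows "C_k_on k (\<lambda>x. sqrt (f x)) S"
proof -
  have "sqrt (f x) = f x powr (1/2)" if "x \<in> S" for x
    using assms(2)[OF that] by (simp add: powr_half_sqrt)
  then show ?thesis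
    using C_k_on_powr[OF assms, of "1/2"]
      C_k_on_cong[of S "\<lambda>x. sqrt (f x)" "\<lambda>x. f x powr (1/2)"] by simp
qed

text \<open>
  The division lemma of Hadamard, one-sided at the axis: the quotient is
  \<open>v r = \<integral>\<^sub>0\<^sup>1 f' (r t) dt\<close>, whose \<open>i\<close>-th derivative is
  \<open>\<integral>\<^sub>0\<^sup>1 t\<^sup>i f\<^sub>i\<^sub>+\<^sub>1 (r t) dt\<close>, where \<open>f\<^sub>j\<close> is the \<open>j\<close>-th derivative of \<open>f\<close>.
\<close>

lemma C_k_on_factor_axis:
  fixes b :: real
  assumes "C_k_on (Suc k) f {0..<b}" "f 0 = 0"
  shows "\<exists>v. C_k_on k v {0..<b} \<and> (\<forall>r\<in>{0..<b}. f r = r * v r)"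
proof -
  let ?S = "{0..<b}"
  obtain D where D: "\<And>x. x \<in> ?S \<Longrightarrow> D 0 x = f x"
    "\<And>i x. i < Suc k \<Longrightarrow> x \<in> ?S \<Longrightarrow> (D i has_real_derivative D (Suc i) x) (at x within ?S)"
    "continuous_on ?S (D (Suc k))"
    using assms(1) unfolding C_k_on_def by blast
  have cont: "continuous_on ?S (D i)" if "i \<le> Suc k" for i
    using that D(2)[of i] D(3) DERIV_continuous_on[of ?S "D i" "D (Suc i)"]
    by (cases "i = Suc k") auto
  have scale: "r * t \<in> ?S" if "r \<in> ?S" "t \<in> {0..1}" for r t :: real
  proof -
    have "0 \<le> r * t" "r * t \<le> r * 1"
      using that by (intro mult_nonneg_nonneg mult_left_mono; simp)+
    then show ?thesis using that by simp
  qed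
  have joint: "continuous_on (?S \<times> cbox 0 1) (\<lambda>(r, t). t ^ j * D i (r * t))" if "i \<le> Suc k" for i j
  proof -
    have "continuous_on (?S \<times> {0..1}) (\<lambda>z. D i (fst z * snd z))"
      by (rule continuous_on_compose2[OF cont[OF that]])
        (use scale in \<open>auto intro!: continuous_intros\<close>)
    then show ?thesis
      by (auto simp: case_prod_unfold intro!: continuous_intros)
  qed
  (* E i is the i-th derivative of the quotient, E 0 the quotient itself. *)
  define E where "E i r = integral (cbox 0 1) (\<lambda>t. t ^ i * D (Suc i) (r * t))" for i r
  have "C_k_on k (E 0) ?S"
    unfolding C_k_on_def
  proof (intro exI[of _ E] conjI ballI allI impI)
    fix i r assume i: "i < k" and r: "r \<in> ?S"
    show "(E i has_real_derivative E (Suc i) r) (at r within ?S)"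
      unfolding E_def
    proof (rule leibniz_rule_field_derivative)
      fix x t :: real assume xt: "x \<in> ?S" "t \<in> cbox 0 1"
      have sub: "(\<lambda>x. x * t) ` ?S \<subseteq> ?S"
        using scale xt by auto
      have "(D (Suc i) has_real_derivative D (Suc (Suc i)) (x * t)) (at (x * t) within (\<lambda>x. x * t) ` ?S)"
        using D(2)[of "Suc i" "x * t"] i scale xt sub
        by (auto intro: DERIV_subset)
      then have "((D (Suc i) \<circ> (\<lambda>x. x * t)) has_real_derivative D (Suc (Suc i)) (x * t) * t) (at x within ?S)"
        by (rule DERIV_image_chain) (auto intro!: derivative_eq_intros)
      then have "((\<lambda>x. D (Suc i) (x * t)) has_real_derivative D (Suc (Suc i)) (x * t) * t) (at x within ?S)"
        by (simp add: comp_def)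
      then show "((\<lambda>x. t ^ i * D (Suc i) (x * t)) has_real_derivative
           t ^ Suc i * D (Suc (Suc i)) (x * t)) (at x within ?S)"
        by (auto intro!: derivative_eq_intros)
    next
      fix x assume x: "x \<in> ?S"
      have "continuous_on (cbox 0 1) (\<lambda>t. D (Suc i) (x * t))"
        by (rule continuous_on_compose2[OF cont[of "Suc i"]])
          (use i x scale in \<open>auto intro!: continuous_intros\<close>)
      then show "(\<lambda>t. t ^ i * D (Suc i) (x * t)) integrable_on cbox 0 1"
        by (intro integrable_continuous continuous_intros)
    next
      show "continuous_on (?S \<times> cbox 0 1) (\<lambda>(x, t). t ^ Suc i * D (Suc (Suc i)) (x * t))"
        using joint[of "Suc (Suc i)" "Suc i"] i by simp
    qed (use r in auto)
  next
    show "continuous_on ?S (E k)"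
      unfolding E_def using joint[of "Suc k" k] by (intro integral_continuous_on_param) auto
  qed auto
  (* The fundamental theorem of calculus along the segment from the axis to r. *)
  moreover have "f r = r * E 0 r" if r: "r \<in> ?S" for r
  proof -
    have "((\<lambda>t. r * D (Suc 0) (r * t)) has_integral (D 0 (r * 1) - D 0 (r * 0))) {0..1}"
    proof (rule fundamental_theorem_of_calculus)
      fix t :: real assume t: "t \<in> {0..1}"
      have sub: "(\<lambda>t. r * t) ` {0..1} \<subseteq> ?S"
        using scale r by auto
      have "(D 0 has_real_derivative D (Suc 0) (r * t)) (at (r * t) within (\<lambda>t. r * t) ` {0..1})"
        using D(2)[of 0 "r * t"] scale r t sub by (auto intro: DERIV_subset)
      then have "((D 0 \<circ> (\<lambda>t. r * t)) has_real_derivative D (Suc 0) (r * t) * r) (at t within {0..1})"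
        by (rule DERIV_image_chain) (auto intro!: derivative_eq_intros)
      then show "((\<lambda>t. D 0 (r * t)) has_vector_derivative r * D (Suc 0) (r * t)) (at t within {0..1})"
        by (simp add: comp_def has_real_derivative_iff_has_vector_derivative mult.commute)
    qed simp
    moreover have "D 0 (r * 1) - D 0 (r * 0) = f r"
      using D(1)[of r] D(1)[of 0] r assms(2) by auto
    ultimately have "f r = integral {0..1} (\<lambda>t. r * D (Suc 0) (r * t))"
      by (metis integral_unique)
    then show ?thesis
      unfolding E_def by simp
  qed
  ultimately show ?thesis by blast
qed

lemma integral_from_axis_has_derivative:
  fixes f :: "real \<Rightarrow> real"
  assumes "continuous_on {0..<b} f" "r \<in> {0..<b}"
  shows "((\<lambda>x. integral {0..x} f) has_real_derivative f r) (at r within {0..<b})"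
proof -
  (* The half-open interval agrees with the compact interval {0..c} near r. *)
  define c where "c = (r + b) / 2"
  have c: "r < c" "c < b" "0 \<le> r"
    using assms(2) by (auto simp: c_def)
  have "continuous_on {0..c} f"
    using assms(1) by (rule continuous_on_subset) (use c in auto)
  then have "((\<lambda>x. integral {0..x} f) has_real_derivative f r) (at r within {0..c})"
    by (rule integral_has_real_derivative) (use c in auto)
  moreover have "at r within {0..c} = at r within {0..<b}"
    by (rule at_within_nhd[where S = "{..<c}"]) (use c in auto)
  ultimately show ?thesis by simp
qed

lemma at_within_axis: "r \<in> {0<..<b} \<Longrightarrow> at r within {0..<b} = at (r :: real)"
  by (rule at_within_interior) (simp add: interior_atLeastLessThan)

lemma eq_on_if_same_derivative:
  fixes f g :: "real \<Rightarrow> real"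
  assumes "continuous_on {0..<b} f" "continuous_on {0..<b} g" "f 0 = g 0"
    and "\<And>r. r \<in> {0<..<b} \<Longrightarrow> (f has_real_derivative d r) (at r)"
    and "\<And>r. r \<in> {0<..<b} \<Longrightarrow> (g has_real_derivative d r) (at r)"
    and "r \<in> {0..<b}"
  shows "f r = g r"
proof (cases "r = 0")
  case False
  then have r: "0 < r" "r < b" using assms(6) by auto
  have "(\<lambda>x. f x - g x) r = (\<lambda>x. f x - g x) 0"
  proof (rule DERIV_isconst2[of 0 r])
    show "continuous_on {0..r} (\<lambda>x. f x - g x)"
      using r by (intro continuous_on_diff continuous_on_subset[OF assms(1)]
          continuous_on_subset[OF assms(2)]) auto
    show "((\<lambda>x. f x - g x) has_real_derivative 0) (at x)" if "0 < x" "x < r" for x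
      using DERIV_diff[OF assms(4)[of x] assms(5)[of x]] that r by simp
  qed (use r in auto)
  then show ?thesis using assms(3) by simp
qed (use assms(3) in simp)

text \<open>
  Uniqueness for \<open>m' = d / l(m)\<close> with \<open>m > 1\<close>, by separation of variables:
  \<open>L\<close> is a primitive of \<open>l\<close>, so \<open>L(m)\<close> has the derivative \<open>d\<close> for every solution.
  The right-hand side \<open>d\<close> is needed off the axis only.
\<close>

lemma eq_of_same_potential_rate:
  assumes L: "\<And>x. x > 1 \<Longrightarrow> (L has_real_derivative l x) (at x)" "\<And>x. x > 1 \<Longrightarrow> l x > 0"
    and m: "continuous_on {0..<b} m" "\<And>r. r \<in> {0..<b} \<Longrightarrow> m r > 1"
      "\<And>r. r \<in> {0<..<b} \<Longrightarrow> (m has_real_derivative d r / l (m r)) (at r)"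
    and n: "continuous_on {0..<b} n" "\<And>r. r \<in> {0..<b} \<Longrightarrow> n r > 1"
      "\<And>r. r \<in> {0<..<b} \<Longrightarrow> (n has_real_derivative d r / l (n r)) (at r)"
    and "m 0 = n 0" "r \<in> {0..<b}"
  shows "m r = (n r :: real)"
proof -
  have contL: "continuous_on {1<..} L"
    by (rule continuous_at_imp_continuous_on) (use L(1) DERIV_isCont in blast)
  have mono: "L x < L y" if "1 < x" "x < y" for x y
    by (rule DERIV_pos_imp_increasing[OF that(2)])
      (use L that in \<open>meson less_le_trans\<close>)
  have chain: "continuous_on {0..<b} (\<lambda>r. L (k r))"
    "\<And>r. r \<in> {0<..<b} \<Longrightarrow> ((\<lambda>r. L (k r)) has_real_derivative d r) (at r)"
    if "continuous_on {0..<b} k" "\<And>r. r \<in> {0..<b} \<Longrightarrow> k r > 1"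
      "\<And>r. r \<in> {0<..<b} \<Longrightarrow> (k has_real_derivative d r / l (k r)) (at r)" for k
  proof -
    show "continuous_on {0..<b} (\<lambda>r. L (k r))"
      by (rule continuous_on_compose2[OF contL that(1)]) (use that(2) in auto)
    fix r assume r: "r \<in> {0<..<b}"
    then have k: "k r > 1" using that(2) by simp
    have "((\<lambda>r. L (k r)) has_real_derivative l (k r) * (d r / l (k r))) (at r)"
      using DERIV_chain2[OF L(1)[OF k] that(3)[OF r]] .
    then show "((\<lambda>r. L (k r)) has_real_derivative d r) (at r)"
      using L(2)[OF k] by simp
  qed
  have "L (m r) = L (n r)"
    using eq_on_if_same_derivative[OF chain(1)[OF m] chain(1)[OF n] _ chain(2)[OF m] chain(2)[OF n]]
      assms(9,10) by simp
  then show ?thesis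
    using mono[of "m r" "n r"] mono[of "n r" "m r"] m(2) n(2) assms(10)
    by (cases "m r" "n r" rule: linorder_cases) auto
qed

section \<open>Equation of state and jump conditions\<close>

lemma gas_density_pos:
  assumes "\<gamma> > 1" "A > 0" "p > 0"
  shows "gas_density \<gamma> A cv p s > 0"
  unfolding gas_density_explicit[OF assms] using assms by simp

lemma gas_density_eq_iff:
  assumes "\<gamma> > 1" "A > 0" "cv > 0" "p > 0" "\<rho> > 0"
  shows "gas_density \<gamma> A cv p s = \<rho> \<longleftrightarrow> s = cv * ln (p / (A * \<rho> powr \<gamma>))"
proof
  assume "gas_density \<gamma> A cv p s = \<rho>"
  then have "\<rho> powr \<gamma> = p / (A * exp (s / cv))"
    using assms unfolding gas_density_explicit[OF assms(1,2,4)]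
    by (auto simp: powr_powr)
  then have "p / (A * \<rho> powr \<gamma>) = exp (s / cv)"
    using assms by simp
  then show "s = cv * ln (p / (A * \<rho> powr \<gamma>))"
    using assms by simp
next
  assume s: "s = cv * ln (p / (A * \<rho> powr \<gamma>))"
  have "exp (s / cv) = p / (A * \<rho> powr \<gamma>)"
    using assms by (simp add: s)
  then show "gas_density \<gamma> A cv p s = \<rho>"
    using assms unfolding gas_density_explicit[OF assms(1,2,4)] by (simp add: powr_powr)
qed

lemma C_k_on_gas_density:
  assumes "\<gamma> > 1" "A > 0" "\<And>x. x \<in> S \<Longrightarrow> p x > 0" "C_k_on k p S" "C_k_on k s S"
  shows "C_k_on k (\<lambda>x. gas_density \<gamma> A cv (p x) (s x)) S"
proof -
  have "C_k_on k (\<lambda>x. (p x / (A * exp (s x * inverse cv))) powr (1 / \<gamma>)) S"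
    using assms by (intro C_k_on_powr C_k_on_divide C_k_on_mult C_k_on_exp C_k_on_const) auto
  then show ?thesis
    using C_k_on_cong[of S "\<lambda>x. (p x / (A * exp (s x * inverse cv))) powr (1 / \<gamma>)"
        "\<lambda>x. gas_density \<gamma> A cv (p x) (s x)" k] gas_density_explicit[OF assms(1,2,3)]
    by (simp add: divide_inverse)
qed

lemma mach_sq_eq:
  assumes "\<gamma> > 1" "A > 0" "pressure U > 0"
  shows "mach_sq \<gamma> A cv U = \<rho>_of \<gamma> A cv U * (speed U)\<^sup>2 / (\<gamma> * pressure U)"
  using assms gas_density_pos[OF assms]
  by (simp add: mach_sq_def sound_speed_sq_def \<rho>_of_def)

lemma gas_speed_relation:
  assumes "\<gamma> > 1" "A > 0" "pressure U > 0" "speed U > 0"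
  shows "\<rho>_of \<gamma> A cv U = \<gamma> * pressure U * mach_sq \<gamma> A cv U / (speed U)\<^sup>2"
  using mach_sq_eq[OF assms(1-3)] assms by simp

lemma sound_speed_sq_over_speed:
  assumes "\<gamma> > 1" "A > 0" "pressure U > 0" "speed U > 0"
  shows "sound_speed_sq \<gamma> A cv U / speed U = speed U / mach_sq \<gamma> A cv U"
  using assms gas_density_pos[OF assms(1-3)]
  by (simp add: mach_sq_def sound_speed_sq_def \<rho>_of_def power2_eq_square)

lemma mu_sq_pos: "\<gamma> > 1 \<Longrightarrow> 0 < mu_sq \<gamma>"
  by (simp add: mu_sq_def)

lemma pressure_rises_iff:
  assumes "\<gamma> > 1" "p > 0"
  shows "p < ((1 + mu_sq \<gamma>) * m - mu_sq \<gamma>) * p \<longleftrightarrow> m > 1"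
proof -
  have "p < ((1 + mu_sq \<gamma>) * m - mu_sq \<gamma>) * p \<longleftrightarrow> 0 < ((1 + mu_sq \<gamma>) * (m - 1)) * p"
    by (simp add: algebra_simps)
  also have "\<dots> \<longleftrightarrow> m > 1"
    using assms mu_sq_pos[OF assms(1)] by (simp add: zero_less_mult_iff)
  finally show ?thesis .
qed

text \<open>
  The ratio \<open>\<rho>\<^sub>+ / \<rho>\<^sub>- = q\<^sub>- / q\<^sub>+\<close> across the front, as a
  function of the squared Mach number ahead.
\<close>

definition density_ratio :: "real \<Rightarrow> real \<Rightarrow> real" where
  "density_ratio \<gamma> m = (\<gamma> + 1) * m / ((\<gamma> - 1) * m + 2)"

lemma density_ratio_pos: "\<gamma> > 1 \<Longrightarrow> m > 0 \<Longrightarrow> density_ratio \<gamma> m > 0"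
  unfolding density_ratio_def by (intro divide_pos_pos mult_pos_pos add_pos_pos; simp)

lemma density_ratio_speed:
  assumes "\<gamma> > 1" "q > 0" "m > 0"
  shows "q / (mu_sq \<gamma> * (q + 2 / (\<gamma> - 1) * (q / m))) = density_ratio \<gamma> m"
proof -
  have "mu_sq \<gamma> * (q + 2 / (\<gamma> - 1) * (q / m)) = q * ((\<gamma> - 1) * m + 2) / ((\<gamma> + 1) * m)"
  proof -
    have "f / e * (q + 2 / f * (q / m)) = q * (f * m + 2) / (e * m)" if "e \<noteq> 0" "f \<noteq> 0" for e f
      using that assms(3) by (simp add: field_simps)
    from this[of "\<gamma> + 1" "\<gamma> - 1"] show ?thesis
      unfolding mu_sq_def using assms(1) by simp
  qed
  moreover have "q / (q * d / c) = c / d" for c d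
    using assms(2) by simp
  ultimately show ?thesis
    unfolding density_ratio_def by metis
qed

text \<open>
  The state behind the front. The entropy is the one for which the equation of state
  gives the density \<open>\<rho>\<^sub>-\<close> times \<open>density_ratio\<close>.
\<close>

definition post_shock :: "real \<Rightarrow> real \<Rightarrow> real \<Rightarrow> flow_state \<Rightarrow> flow_state" where
  "post_shock \<gamma> A cv U =
    (let m = mach_sq \<gamma> A cv U;
         p = ((1 + mu_sq \<gamma>) * m - mu_sq \<gamma>) * pressure U
     in \<lparr>pressure = p, angle = 0, swirl = swirl U,
         speed = speed U / density_ratio \<gamma> m,
         entropy = cv * ln (p / (A * (\<rho>_of \<gamma> A cv U * density_ratio \<gamma> m) powr \<gamma>))\<rparr>)"

lemma \<rho>_of_post_shock:
  assumes "\<gamma> > 1" "A > 0" "cv > 0" "pressure U > 0" "mach_sq \<gamma> A cv U > 1"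
  shows "\<rho>_of \<gamma> A cv (post_shock \<gamma> A cv U) = \<rho>_of \<gamma> A cv U * density_ratio \<gamma> (mach_sq \<gamma> A cv U)"
proof -
  let ?m = "mach_sq \<gamma> A cv U"
  have "((1 + mu_sq \<gamma>) * ?m - mu_sq \<gamma>) * pressure U > 0"
    using pressure_rises_iff[OF assms(1,4)] assms by (meson less_trans)
  moreover have "\<rho>_of \<gamma> A cv U * density_ratio \<gamma> ?m > 0"
    using gas_density_pos[OF assms(1,2,4)] density_ratio_pos[of \<gamma> ?m] assms
    by (simp add: \<rho>_of_def)
  ultimately show ?thesis
    unfolding \<rho>_of_def[where U = "post_shock \<gamma> A cv U"]
    using gas_density_eq_iff[OF assms(1-3)]
    by (simp add: post_shock_def Let_def)
qed

lemma rankine_hugoniot_post_shock: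
  assumes "\<gamma> > 1" "A > 0" "cv > 0" "pressure U > 0" "speed U > 0" "mach_sq \<gamma> A cv U > 1"
  shows "rankine_hugoniot \<gamma> A cv U (post_shock \<gamma> A cv U)"
proof -
  let ?m = "mach_sq \<gamma> A cv U"
  have "density_ratio \<gamma> ?m > 0"
    using density_ratio_pos assms by simp
  moreover have eq: "mu_sq \<gamma> * (speed U + 2 / (\<gamma> - 1) * (speed U / ?m)) = speed U / density_ratio \<gamma> ?m"
    using density_ratio_speed[of \<gamma> "speed U" ?m, symmetric] assms by simp
  ultimately show ?thesis
    unfolding rankine_hugoniot_def sound_speed_sq_over_speed[OF assms(1,2,4,5)]
      \<rho>_of_post_shock[OF assms(1-4,6)] eq
    using assms by (simp add: post_shock_def Let_def)
qed

lemma rankine_hugoniot_unique: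
  assumes "\<gamma> > 1" "A > 0" "cv > 0" "pressure U > 0" "speed U > 0" "mach_sq \<gamma> A cv U > 1"
    and "rankine_hugoniot \<gamma> A cv U V" "angle V = 0" "pressure V > 0"
  shows "V = post_shock \<gamma> A cv U"
proof -
  let ?W = "post_shock \<gamma> A cv U"
  have W: "rankine_hugoniot \<gamma> A cv U ?W"
    using rankine_hugoniot_post_shock assms by simp
  have eq: "pressure V = pressure ?W" "speed V = speed ?W" "swirl V = swirl ?W"
    "\<rho>_of \<gamma> A cv V = \<rho>_of \<gamma> A cv ?W"
    using W assms(7) unfolding rankine_hugoniot_def by simp_all
  have "entropy V = entropy ?W"
    using eq(1,4) gas_density_eq_iff[OF assms(1-3,9)] gas_density_pos[OF assms(1,2,9)]
    unfolding \<rho>_of_def by metis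
  moreover have "angle ?W = 0"
    by (simp add: post_shock_def Let_def)
  ultimately show ?thesis
    using eq assms(8) by simp
qed

lemma post_shock_reverse_swirl:
  "post_shock \<gamma> A cv (reverse_swirl U) = reverse_swirl (post_shock \<gamma> A cv U)"
  by (simp add: post_shock_def reverse_swirl_def mach_sq_def sound_speed_sq_def \<rho>_of_def Let_def)

section \<open>Radial balance on both sides of the front\<close>

text \<open>
  The function \<open>F\<close> in the equation \<open>m' = - F(m) p' / p\<close> for the squared Mach number
  ahead of the front.
\<close>

definition mach_rate :: "real \<Rightarrow> real \<Rightarrow> real" where
  "mach_rate \<gamma> m = (\<gamma> - 1) * ((m - 1) * (\<gamma> * m + 1)) / (\<gamma> * ((\<gamma> - 1) * m + 2))"

lemma mach_rate_pos: "\<gamma> > 1 \<Longrightarrow> m > 1 \<Longrightarrow> mach_rate \<gamma> m > 0"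
  unfolding mach_rate_def by (intro divide_pos_pos mult_pos_pos add_pos_pos; simp)

text \<open>
  The algebraic reason for the form of \<open>mach_rate\<close>: for \<open>p > 0\<close> the derivative of
  \<open>((1 + \<mu>\<^sup>2) m - \<mu>\<^sup>2) p\<close> equals \<open>density_ratio \<gamma> m\<close> times \<open>p'\<close> exactly when
  \<open>m' = - mach_rate \<gamma> m * p' / p\<close>.
\<close>

lemma mach_rate_identity:
  assumes "\<gamma> > 1" "m > 0"
  shows "(1 + mu_sq \<gamma>) * mach_rate \<gamma> m = (1 + mu_sq \<gamma>) * m - mu_sq \<gamma> - density_ratio \<gamma> m"
proof -
  have *: "(\<gamma> - 1) * m + 2 \<noteq> 0" "\<gamma> + 1 \<noteq> 0" "\<gamma> \<noteq> 0"
    using assms by (auto simp: add_pos_pos intro!: less_imp_neq[symmetric])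
  have a: "1 + mu_sq \<gamma> = 2 * \<gamma> / (\<gamma> + 1)"
    unfolding mu_sq_def using * by (simp add: field_simps)
  define d where "d = (\<gamma> - 1) * m + 2"
  have d: "d \<noteq> 0" using * by (simp add: d_def)
  have "2 * ((\<gamma> - 1) * ((m - 1) * (\<gamma> * m + 1))) =
      (2 * \<gamma> * m - (\<gamma> - 1)) * d - (\<gamma> + 1) * ((\<gamma> + 1) * m)"
    unfolding d_def by algebra
  moreover have "(1 + mu_sq \<gamma>) * mach_rate \<gamma> m =
      2 * ((\<gamma> - 1) * ((m - 1) * (\<gamma> * m + 1))) / ((\<gamma> + 1) * d)"
    unfolding a mach_rate_def d_def[symmetric] using * by simp
  moreover have "(1 + mu_sq \<gamma>) * m - mu_sq \<gamma> - density_ratio \<gamma> m =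
      ((2 * \<gamma> * m - (\<gamma> - 1)) * d - (\<gamma> + 1) * ((\<gamma> + 1) * m)) / ((\<gamma> + 1) * d)"
  proof -
    have "2 * \<gamma> / e * m - f / e - e * m / d = ((2 * \<gamma> * m - f) * d - e * (e * m)) / (e * d)"
      if "e \<noteq> 0" for e f
      using that d by (simp add: field_simps)
    from this[OF *(2), of "\<gamma> - 1"] show ?thesis
      unfolding a unfolding density_ratio_def d_def[symmetric] mu_sq_def by simp
  qed
  ultimately show ?thesis by simp
qed

text \<open>
  Here \<open>P\<close> is the pressure behind the front. That \<open>m\<close> is differentiable is part of the
  conclusion, since \<open>m\<close> is a function of \<open>P / p\<close>.
\<close>

lemma mach_rate_of_balances:
  fixes p m P :: "real \<Rightarrow> real"
  assumes "\<gamma> > 1" "open S" "r \<in> S" "\<And>x. x \<in> S \<Longrightarrow> p x > 0" "m r > 1"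
    and P: "\<And>x. x \<in> S \<Longrightarrow> P x = ((1 + mu_sq \<gamma>) * m x - mu_sq \<gamma>) * p x"
    and p': "(p has_real_derivative p') (at r)"
    and P': "(P has_real_derivative density_ratio \<gamma> (m r) * p') (at r)"
  shows "(m has_real_derivative - mach_rate \<gamma> (m r) * (p' / p r)) (at r)"
proof -
  let ?a = "1 + mu_sq \<gamma>"
  have a: "?a > 0" and p: "p r > 0"
    using mu_sq_pos[OF assms(1)] assms by simp_all
  (* Differentiate m = (P / p + \<mu>\<^sup>2) / (1 + \<mu>\<^sup>2). *)
  have "((\<lambda>x. (P x / p x + mu_sq \<gamma>) / ?a) has_real_derivative
      (density_ratio \<gamma> (m r) * p' * p r - P r * p') / (p r * p r) / ?a) (at r)"
    using a p by (auto intro!: derivative_eq_intros p' P')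
  moreover have "(density_ratio \<gamma> (m r) * p' * p r - P r * p') / (p r * p r) / ?a =
      - mach_rate \<gamma> (m r) * (p' / p r)"
  proof -
    have "density_ratio \<gamma> (m r) - (?a * m r - mu_sq \<gamma>) = - (?a * mach_rate \<gamma> (m r))"
      using mach_rate_identity[of \<gamma> "m r"] assms by simp
    moreover have "(density_ratio \<gamma> (m r) * p' * p r - P r * p') =
        (density_ratio \<gamma> (m r) - (?a * m r - mu_sq \<gamma>)) * p' * p r"
      unfolding P[OF assms(3)] by algebra
    ultimately show ?thesis using a p by simp
  qed
  moreover have "(P x / p x + mu_sq \<gamma>) / ?a = m x" if "x \<in> S" for x
    using P[OF that] assms(4)[OF that] a by simp
  ultimately show ?thesis
    using has_field_derivative_transform_within_open assms(2,3) by (metis (lifting))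
qed

lemma balance_behind_front:
  fixes p m :: "real \<Rightarrow> real"
  assumes "\<gamma> > 1" "p r > 0" "m r > 1"
    and p': "(p has_real_derivative p') (at r)"
    and m': "(m has_real_derivative - mach_rate \<gamma> (m r) * (p' / p r)) (at r)"
  shows "((\<lambda>x. ((1 + mu_sq \<gamma>) * m x - mu_sq \<gamma>) * p x) has_real_derivative
     density_ratio \<gamma> (m r) * p') (at r)"
proof -
  let ?a = "1 + mu_sq \<gamma>"
  have ratio: "density_ratio \<gamma> (m r) = (?a * m r - mu_sq \<gamma>) - (?a * mach_rate \<gamma> (m r))"
    using mach_rate_identity[of \<gamma> "m r"] assms by simp
  have "((\<lambda>x. (?a * m x - mu_sq \<gamma>) * p x) has_real_derivative
      (?a * (- mach_rate \<gamma> (m r) * (p' / p r))) * p r + (?a * m r - mu_sq \<gamma>) * p') (at r)"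
    by (auto intro!: derivative_eq_intros p' m')
  also have "(?a * (- mach_rate \<gamma> (m r) * (p' / p r))) * p r + (?a * m r - mu_sq \<gamma>) * p' =
      density_ratio \<gamma> (m r) * p'"
    unfolding ratio using assms(2) by (simp add: left_diff_distrib)
  finally show ?thesis .
qed

lemma swirl_profileD:
  assumes "swirl_profile r0 U"
  shows "C_k_on 7 (\<lambda>r. pressure (U r)) {0..<r0}" "C_k_on 7 (\<lambda>r. swirl (U r)) {0..<r0}"
    "C_k_on 7 (\<lambda>r. speed (U r)) {0..<r0}" "C_k_on 7 (\<lambda>r. entropy (U r)) {0..<r0}"
    "r \<in> {0..<r0} \<Longrightarrow> angle (U r) = 0" "r \<in> {0..<r0} \<Longrightarrow> pressure (U r) > 0"
    "r \<in> {0..<r0} \<Longrightarrow> speed (U r) > 0"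
  using assms unfolding swirl_profile_def by auto

lemma C_k_on_\<rho>_of:
  assumes "\<gamma> > 1" "A > 0" "swirl_profile r0 U"
  shows "C_k_on 7 (\<lambda>r. \<rho>_of \<gamma> A cv (U r)) {0..<r0}"
  unfolding \<rho>_of_def
  by (rule C_k_on_gas_density) (use assms swirl_profileD[OF assms(3)] in auto)

lemma C_k_on_mach_sq:
  assumes "\<gamma> > 1" "A > 0" "swirl_profile r0 U"
  shows "C_k_on 7 (\<lambda>r. mach_sq \<gamma> A cv (U r)) {0..<r0}"
proof -
  note U = swirl_profileD[OF assms(3)]
  have "C_k_on 7 (\<lambda>r. \<rho>_of \<gamma> A cv (U r) * (speed (U r))\<^sup>2 / (\<gamma> * pressure (U r))) {0..<r0}"
  proof (intro C_k_on_divide C_k_on_mult C_k_on_power C_k_on_const U C_k_on_\<rho>_of assms)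
    show "\<gamma> * pressure (U r) \<noteq> 0" if "r \<in> {0..<r0}" for r
      using U(6)[OF that] assms(1) by simp
  qed
  then show ?thesis
    using C_k_on_cong[of "{0..<r0}" "\<lambda>r. mach_sq \<gamma> A cv (U r)"
        "\<lambda>r. \<rho>_of \<gamma> A cv (U r) * (speed (U r))\<^sup>2 / (\<gamma> * pressure (U r))" 7]
      mach_sq_eq[OF assms(1,2)] U(6) by simp
qed

lemma radial_balance_iff:
  "radial_balance \<gamma> A cv r0 (\<lambda>r. pressure (U r)) (\<lambda>r. swirl (U r)) (\<lambda>r. entropy (U r)) \<longleftrightarrow>
    (\<forall>r\<in>{0<..<r0}. ((\<lambda>r. pressure (U r)) has_real_derivative
      (1 / r * \<rho>_of \<gamma> A cv (U r) * (swirl (U r))\<^sup>2)) (at r))"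
  unfolding radial_balance_def \<rho>_of_def ..

text \<open>
  What a special shock solution amounts to in terms of the flow ahead of the front: it is
  supersonic, its squared Mach number obeys the scalar differential equation, and the flow behind
  is its image under \<open>post_shock\<close>. The lemma \<open>special_shock_solution_post_shock\<close> is the
  converse.
\<close>

lemma special_shock_solutionD:
  assumes "\<gamma> > 1" "A > 0" "cv > 0" and sol: "special_shock_solution \<gamma> A cv L r0 U V \<phi>"
  shows "swirl_profile r0 U"
    and "\<And>r. r \<in> {0<..<r0} \<Longrightarrow> ((\<lambda>r. pressure (U r)) has_real_derivative
      (1 / r * \<rho>_of \<gamma> A cv (U r) * (swirl (U r))\<^sup>2)) (at r)"
    and "\<And>r. r \<in> {0..<r0} \<Longrightarrow> mach_sq \<gamma> A cv (U r) > 1"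
    and "\<And>r. r \<in> {0..<r0} \<Longrightarrow> V r = post_shock \<gamma> A cv (U r)"
    and "\<And>r. r \<in> {0<..<r0} \<Longrightarrow> ((\<lambda>r. mach_sq \<gamma> A cv (U r)) has_real_derivative
      - mach_rate \<gamma> (mach_sq \<gamma> A cv (U r)) *
        (1 / r * \<rho>_of \<gamma> A cv (U r) * (swirl (U r))\<^sup>2 / pressure (U r))) (at r)"
proof -
  show U: "swirl_profile r0 U"
    using sol unfolding special_shock_solution_def by simp
  note U' = swirl_profileD[OF U]
  have V: "swirl_profile r0 V"
    using sol unfolding special_shock_solution_def by simp
  note V' = swirl_profileD[OF V]
  show dp: "((\<lambda>r. pressure (U r)) has_real_derivative
      (1 / r * \<rho>_of \<gamma> A cv (U r) * (swirl (U r))\<^sup>2)) (at r)" if "r \<in> {0<..<r0}" for r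
    using sol that unfolding special_shock_solution_def radial_balance_iff by simp
  have RH: "rankine_hugoniot \<gamma> A cv (U r) (V r)" and jump: "pressure (U r) < pressure (V r)"
    if "r \<in> {0..<r0}" for r
    using sol that unfolding special_shock_solution_def by simp_all
  show m: "mach_sq \<gamma> A cv (U r) > 1" if r: "r \<in> {0..<r0}" for r
    using RH[OF r] jump[OF r] pressure_rises_iff[OF assms(1) U'(6)[OF r]]
    unfolding rankine_hugoniot_def by simp
  show post: "V r = post_shock \<gamma> A cv (U r)" if r: "r \<in> {0..<r0}" for r
    using rankine_hugoniot_unique[OF assms(1-3) U'(6,7)[OF r] m[OF r] RH[OF r] V'(5,6)[OF r]] .
  (* Rewritten through the flow ahead, the balance behind the front carries the density ratio as
     a factor. *)
  fix r assume r: "r \<in> {0<..<r0}"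
  show "((\<lambda>r. mach_sq \<gamma> A cv (U r)) has_real_derivative
      - mach_rate \<gamma> (mach_sq \<gamma> A cv (U r)) *
        (1 / r * \<rho>_of \<gamma> A cv (U r) * (swirl (U r))\<^sup>2 / pressure (U r))) (at r)"
  proof (rule mach_rate_of_balances[OF assms(1), where S = "{0<..<r0}" and P = "\<lambda>r. pressure (V r)"])
    have r': "r \<in> {0..<r0}" using r by simp
    have "((\<lambda>r. pressure (V r)) has_real_derivative
        (1 / r * \<rho>_of \<gamma> A cv (V r) * (swirl (V r))\<^sup>2)) (at r)"
      using sol r unfolding special_shock_solution_def radial_balance_iff by simp
    moreover have "\<rho>_of \<gamma> A cv (V r) = \<rho>_of \<gamma> A cv (U r) * density_ratio \<gamma> (mach_sq \<gamma> A cv (U r))"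
      using \<rho>_of_post_shock[OF assms(1-3) U'(6)[OF r'] m[OF r']] post[OF r'] by simp
    moreover have "swirl (V r) = swirl (U r)"
      using RH[OF r'] unfolding rankine_hugoniot_def by simp
    ultimately show "((\<lambda>r. pressure (V r)) has_real_derivative
        density_ratio \<gamma> (mach_sq \<gamma> A cv (U r)) *
        (1 / r * \<rho>_of \<gamma> A cv (U r) * (swirl (U r))\<^sup>2)) (at r)"
      by (simp add: mult_ac)
    show "pressure (V x) =
        ((1 + mu_sq \<gamma>) * mach_sq \<gamma> A cv (U x) - mu_sq \<gamma>) * pressure (U x)" if "x \<in> {0<..<r0}" for x
      using RH[of x] that unfolding rankine_hugoniot_def by simp
  qed (use r dp m U'(6) in auto)
qed

lemma special_shock_solution_post_shock:
  assumes "\<gamma> > 1" "A > 0" "cv > 0" and U: "swirl_profile r0 U"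
    and dp: "\<And>r. r \<in> {0<..<r0} \<Longrightarrow> ((\<lambda>r. pressure (U r)) has_real_derivative
      (1 / r * \<rho>_of \<gamma> A cv (U r) * (swirl (U r))\<^sup>2)) (at r)"
    and m: "\<And>r. r \<in> {0..<r0} \<Longrightarrow> mach_sq \<gamma> A cv (U r) > 1"
    and dm: "\<And>r. r \<in> {0<..<r0} \<Longrightarrow> ((\<lambda>r. mach_sq \<gamma> A cv (U r)) has_real_derivative
      - mach_rate \<gamma> (mach_sq \<gamma> A cv (U r)) *
        (1 / r * \<rho>_of \<gamma> A cv (U r) * (swirl (U r))\<^sup>2 / pressure (U r))) (at r)"
    and "zs \<in> {0<..<L}"
  shows "special_shock_solution \<gamma> A cv L r0 U (\<lambda>r. post_shock \<gamma> A cv (U r)) (\<lambda>r. zs)"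
proof -
  let ?S = "{0..<r0}"
  let ?m = "\<lambda>r. mach_sq \<gamma> A cv (U r)"
  let ?P = "\<lambda>r. ((1 + mu_sq \<gamma>) * ?m r - mu_sq \<gamma>) * pressure (U r)"
  let ?R = "\<lambda>r. \<rho>_of \<gamma> A cv (U r) * density_ratio \<gamma> (?m r)"
  note U' = swirl_profileD[OF U]
  (* ?P and ?R are the pressure and the density behind the front. *)
  have P: "?P r > pressure (U r)" "?P r > 0" if "r \<in> ?S" for r
    using pressure_rises_iff[OF assms(1) U'(6)[OF that], of "?m r"] m[OF that] U'(6)[OF that]
    by linarith+
  have den: "(\<gamma> - 1) * ?m r + 2 > 0" if "r \<in> ?S" for r
    using m[OF that] assms(1) by (intro add_pos_pos mult_pos_pos) auto
  have ratio: "density_ratio \<gamma> (?m r) > 0" if "r \<in> ?S" for r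
    using density_ratio_pos[OF assms(1), of "?m r"] m[OF that] by simp
  have R: "?R r > 0" if "r \<in> ?S" for r
    using ratio[OF that] gas_density_pos[OF assms(1,2) U'(6)[OF that]] by (simp add: \<rho>_of_def)
  note C_m = C_k_on_mach_sq[OF assms(1,2) U, of cv]
  have C_ratio: "C_k_on 7 (\<lambda>r. density_ratio \<gamma> (?m r)) ?S"
    unfolding density_ratio_def
    by (intro C_k_on_divide C_k_on_mult C_k_on_add C_k_on_const C_m) (use den in force)
  have C_P: "C_k_on 7 ?P ?S"
    by (intro C_k_on_mult C_k_on_diff C_k_on_const C_m U')
  have C_R: "C_k_on 7 ?R ?S"
    by (intro C_k_on_mult C_ratio C_k_on_\<rho>_of assms)
  have "C_k_on 7 (\<lambda>r. cv * ln (?P r / (A * ?R r powr \<gamma>))) ?S"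
  proof (rule C_k_on_mult[OF C_k_on_const C_k_on_ln[OF C_k_on_divide[OF C_P
          C_k_on_mult[OF C_k_on_const C_k_on_powr[OF C_R R]]]]])
    fix r assume r: "r \<in> ?S"
    have "A * ?R r powr \<gamma> > 0" using R[OF r] assms(2)
      by (metis mult_pos_pos powr_gt_zero less_irrefl)
    then show "?P r / (A * ?R r powr \<gamma>) > 0" "A * ?R r powr \<gamma> \<noteq> 0"
      using P(2)[OF r] by (auto intro: divide_pos_pos)
  qed
  moreover have "C_k_on 7 (\<lambda>r. speed (U r) / density_ratio \<gamma> (?m r)) ?S"
    by (intro C_k_on_divide C_ratio U') (use ratio in force)
  ultimately have profile: "swirl_profile r0 (\<lambda>r. post_shock \<gamma> A cv (U r))"
    unfolding swirl_profile_def using C_P U'(2,7) P(2) ratio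
    by (simp add: post_shock_def Let_def)
  have "((\<lambda>r. pressure (post_shock \<gamma> A cv (U r))) has_real_derivative
      (1 / r * \<rho>_of \<gamma> A cv (post_shock \<gamma> A cv (U r)) * (swirl (post_shock \<gamma> A cv (U r)))\<^sup>2)) (at r)"
    if r: "r \<in> {0<..<r0}" for r
  proof -
    have r': "r \<in> ?S" using r by simp
    have "(?P has_real_derivative
        density_ratio \<gamma> (?m r) * (1 / r * \<rho>_of \<gamma> A cv (U r) * (swirl (U r))\<^sup>2)) (at r)"
      using balance_behind_front[OF assms(1) _ _ dp[OF r] dm[OF r]] U'(6)[OF r'] m[OF r'] by blast
    then show ?thesis
      unfolding \<rho>_of_post_shock[OF assms(1-3) U'(6)[OF r'] m[OF r']]
      by (simp add: post_shock_def Let_def mult_ac)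
  qed
  then show ?thesis
    unfolding special_shock_solution_def radial_balance_iff
    using assms(8) U profile dp P(1) rankine_hugoniot_post_shock[OF assms(1-3) U'(6,7) m]
    by (auto simp: post_shock_def Let_def)
qed

section \<open>First integrals of the Mach number equation\<close>

text \<open>
  The primitive \<open>N\<close> of \<open>1 / mach_rate\<close> on \<open>(1, \<infinity>)\<close>, from the partial fractions of
  the latter; along every solution \<open>mach_potential \<gamma> m + ln p\<close> is constant.
\<close>

definition mach_potential :: "real \<Rightarrow> real \<Rightarrow> real" where
  "mach_potential \<gamma> m = (\<gamma> * ln (m - 1) - ln (\<gamma> * m + 1)) / (\<gamma> - 1)"

lemma mach_potential_deriv:
  assumes "\<gamma> > 1" "m > 1"
  shows "(mach_potential \<gamma> has_real_derivative inverse (mach_rate \<gamma> m)) (at m)"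
proof -
  have pos: "m - 1 > 0" "\<gamma> * m + 1 > 0" "\<gamma> > 0" "\<gamma> - 1 > 0"
    using assms by (auto simp: add_pos_pos)
  have "(mach_potential \<gamma> has_real_derivative
      (\<gamma> * (1 / (m - 1)) - \<gamma> / (\<gamma> * m + 1)) / (\<gamma> - 1)) (at m)"
    unfolding mach_potential_def[abs_def] using pos
    by (auto intro!: derivative_eq_intros)
  also have "(\<gamma> * (1 / (m - 1)) - \<gamma> / (\<gamma> * m + 1)) / (\<gamma> - 1) = inverse (mach_rate \<gamma> m)"
  proof -
    have "(\<gamma> * (1 / u) - \<gamma> / v) / c = inverse (c * (u * v) / (\<gamma> * (v - u)))"
      if "u > 0" "v > 0" "c > 0" for u v c
      using that pos by (simp add: field_simps)
    from this[OF pos(1,2,4)] show ?thesis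
      unfolding mach_rate_def by (simp add: algebra_simps)
  qed
  finally show ?thesis .
qed

lemma continuous_on_mach_potential: "\<gamma> > 1 \<Longrightarrow> continuous_on {1<..} (mach_potential \<gamma>)"
  by (rule continuous_at_imp_continuous_on) (use mach_potential_deriv DERIV_isCont in blast)

lemma mach_potential_strict_mono:
  assumes "\<gamma> > 1" "1 < m" "m < n"
  shows "mach_potential \<gamma> m < mach_potential \<gamma> n"
proof (rule DERIV_pos_imp_increasing[OF assms(3)])
  fix x assume "m \<le> x" "x \<le> n"
  then have "1 < x" using assms by simp
  then show "\<exists>y. (mach_potential \<gamma> has_real_derivative y) (at x) \<and> 0 < y"
    using mach_potential_deriv mach_rate_pos assms by (metis inverse_positive_iff_positive)
qed

lemma mach_potential_inj:
  assumes "\<gamma> > 1" "1 < m" "1 < n" "mach_potential \<gamma> m = mach_potential \<gamma> n"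
  shows "m = n"
  using assms mach_potential_strict_mono[of \<gamma> m n] mach_potential_strict_mono[of \<gamma> n m]
  by (cases m n rule: linorder_cases) auto

lemma mach_potential_surj:
  assumes "\<gamma> > 1"
  shows "\<exists>m>1. mach_potential \<gamma> m = y"
proof -
  (* The points a and b satisfy N(a) \<le> - \<bar>y\<bar> and \<bar>y\<bar> \<le> N(b) for the potential N, because
     ln (\<gamma> a + 1) \<ge> 0, and \<gamma> b + 1 \<le> 3 \<gamma> (b - 1) for b \<ge> 2. *)
  define a where "a = 1 + exp (- \<bar>y\<bar>)"
  define b where "b = 1 + exp (\<bar>y\<bar> + ln (3 * \<gamma>) / (\<gamma> - 1))"
  have c: "\<gamma> - 1 > 0" using assms by simp
  have a: "a > 1" by (simp add: a_def)
  have l: "ln (3 * \<gamma>) / (\<gamma> - 1) \<ge> 0"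
    using assms by simp
  have ab: "a \<le> b" and b: "b \<ge> 2"
    using l by (simp_all add: a_def b_def)
  have "mach_potential \<gamma> a \<le> y"
  proof -
    have "ln (\<gamma> * a + 1) \<ge> 0"
      using assms a by simp
    then have "\<gamma> * ln (a - 1) - ln (\<gamma> * a + 1) \<le> - (\<gamma> * \<bar>y\<bar>)"
      by (simp add: a_def)
    also have "\<dots> \<le> - ((\<gamma> - 1) * \<bar>y\<bar>)"
      by (simp add: left_diff_distrib)
    finally have "mach_potential \<gamma> a \<le> - \<bar>y\<bar>"
      unfolding mach_potential_def using c by (simp add: field_simps)
    then show ?thesis by linarith
  qed
  moreover have "y \<le> mach_potential \<gamma> b"
  proof -
    have "\<gamma> * b + 1 \<le> 3 * \<gamma> * (b - 1)"
    proof -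
      have "\<gamma> * 2 \<le> \<gamma> * b" using b assms by (intro mult_left_mono) auto
      moreover have "3 * \<gamma> * (b - 1) = 3 * (\<gamma> * b) - 3 * \<gamma>"
        by algebra
      ultimately show ?thesis using assms by linarith
    qed
    moreover have "\<gamma> * b + 1 > 0" using assms b by (simp add: add_pos_pos)
    ultimately have "ln (\<gamma> * b + 1) \<le> ln (3 * \<gamma> * (b - 1))"
      by simp
    also have "\<dots> = ln (3 * \<gamma>) + ln (b - 1)"
      by (rule ln_mult_pos) (use assms b in auto)
    finally have "(\<gamma> - 1) * ln (b - 1) - ln (3 * \<gamma>) \<le> \<gamma> * ln (b - 1) - ln (\<gamma> * b + 1)"
      by (simp add: left_diff_distrib)
    moreover have "ln (b - 1) = \<bar>y\<bar> + ln (3 * \<gamma>) / (\<gamma> - 1)"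
      by (simp add: b_def)
    then have "(\<gamma> - 1) * ln (b - 1) - ln (3 * \<gamma>) = (\<gamma> - 1) * \<bar>y\<bar>"
      using c by (simp add: distrib_left)
    ultimately have "\<bar>y\<bar> \<le> mach_potential \<gamma> b"
      unfolding mach_potential_def using c by (simp add: field_simps)
    then show ?thesis by linarith
  qed
  moreover have "continuous_on {a..b} (mach_potential \<gamma>)"
    using continuous_on_mach_potential[OF assms]
    by (rule continuous_on_subset) (use a in auto)
  ultimately obtain m where "a \<le> m" "mach_potential \<gamma> m = y"
    using IVT'[of "mach_potential \<gamma>" a y b] ab by auto
  then show ?thesis using a by (intro exI[of _ m]) auto
qed

lemma mach_potential_inverse:
  assumes "\<gamma> > 1"
  obtains g where "\<And>y. g y > 1" "\<And>y. mach_potential \<gamma> (g y) = y"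
    "\<And>m. m > 1 \<Longrightarrow> g (mach_potential \<gamma> m) = m"
    "\<And>y. (g has_real_derivative mach_rate \<gamma> (g y)) (at y)"
proof -
  obtain g where g: "g y > 1" "mach_potential \<gamma> (g y) = y" for y
    using mach_potential_surj[OF assms] by metis
  have inv: "g (mach_potential \<gamma> m) = m" if "m > 1" for m
    using mach_potential_inj[OF assms] g that by blast
  have "(g has_real_derivative mach_rate \<gamma> (g y)) (at y)" for y
    unfolding has_field_derivative_def
  proof (rule has_derivative_inverse_strong_x[where S = "{1<..}" and f = "mach_potential \<gamma>"])
    show "(mach_potential \<gamma> has_derivative (*) (inverse (mach_rate \<gamma> (g y)))) (at (g y))"
      using mach_potential_deriv[OF assms g(1)] unfolding has_field_derivative_def .
    show "(*) (inverse (mach_rate \<gamma> (g y))) \<circ> (*) (mach_rate \<gamma> (g y)) = id"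
      using mach_rate_pos[OF assms g(1), of y] by (simp add: fun_eq_iff)
    show "continuous_on {1<..} (mach_potential \<gamma>)"
      using continuous_on_mach_potential[OF assms] .
  qed (use g inv in auto)
  then show ?thesis
    using that[of g] g inv by blast
qed

text \<open>
  The primitive of \<open>1 / (m * mach_rate \<gamma> m)\<close> on \<open>(1, \<infinity>)\<close>; along every solution
  \<open>swirl_potential \<gamma> m\<close> has the derivative \<open>- \<gamma> w\<^sup>2 / (r q\<^sup>2)\<close>, which does not
  involve the pressure.
\<close>

definition swirl_potential :: "real \<Rightarrow> real \<Rightarrow> real" where
  "swirl_potential \<gamma> m = \<gamma> * (ln (m - 1) + ln (\<gamma> * m + 1) - 2 * ln m) / (\<gamma> - 1)"

lemma swirl_potential_deriv:
  assumes "\<gamma> > 1" "m > 1"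
  shows "(swirl_potential \<gamma> has_real_derivative inverse (m * mach_rate \<gamma> m)) (at m)"
proof -
  have pos: "m - 1 > 0" "\<gamma> * m + 1 > 0" "\<gamma> > 0" "\<gamma> - 1 > 0" "m > 0"
    using assms by (auto simp: add_pos_pos)
  have "(swirl_potential \<gamma> has_real_derivative
      \<gamma> * (1 / (m - 1) + \<gamma> / (\<gamma> * m + 1) - 2 / m) / (\<gamma> - 1)) (at m)"
    unfolding swirl_potential_def[abs_def] using pos
    by (auto intro!: derivative_eq_intros)
  also have "\<gamma> * (1 / (m - 1) + \<gamma> / (\<gamma> * m + 1) - 2 / m) / (\<gamma> - 1) = inverse (m * mach_rate \<gamma> m)"
  proof -
    have "\<gamma> * (1 / u + \<gamma> / v - 2 / m) / c =
        inverse (m * (c * (u * v) / (\<gamma> * (v * m + \<gamma> * (u * m) - 2 * (u * v)))))"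
      if "u > 0" "v > 0" "c > 0" for u v c
      using that pos by (simp add: field_simps)
    moreover have "(\<gamma> * m + 1) * m + \<gamma> * ((m - 1) * m) - 2 * ((m - 1) * (\<gamma> * m + 1)) =
        (\<gamma> - 1) * m + 2"
      by algebra
    ultimately show ?thesis
      unfolding mach_rate_def using pos by simp
  qed
  finally show ?thesis .
qed

section \<open>Global solutions of the Mach number equation\<close>

lemma C_k_on_mach_rate:
  assumes "\<gamma> > 1" "C_k_on k m S" "\<And>x. x \<in> S \<Longrightarrow> m x > 0"
  shows "C_k_on k (\<lambda>x. mach_rate \<gamma> (m x)) S"
proof -
  have "\<gamma> * ((\<gamma> - 1) * m x + 2) \<noteq> 0" if "x \<in> S" for x
  proof -
    have "(\<gamma> - 1) * m x > 0" using assms(1) assms(3)[OF that] by simp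
    then show ?thesis using assms(1) by simp
  qed
  then show ?thesis
    unfolding mach_rate_def
    by (intro C_k_on_divide C_k_on_mult C_k_on_diff C_k_on_add C_k_on_const assms(2)) auto
qed

text \<open>
  In terms of \<open>x = 1 / m\<close> the equation integrates to
  \<open>(1 - x) (\<gamma> + x) = K\<close> with \<open>K = K0 exp ((1 - \<gamma>) \<integral>h)\<close>. Since \<open>0 < K < \<gamma>\<close>, the
  larger root \<open>x\<close> of this quadratic lies in \<open>(0, 1)\<close>; \<open>d\<close> is its discriminant.
\<close>

lemma mach_ode_given_swirl:
  fixes h :: "real \<Rightarrow> real"
  assumes "\<gamma> > 1" "m0 > 1" and h: "C_k_on k h {0..<b}" and h0: "\<And>r. r \<in> {0..<b} \<Longrightarrow> h r \<ge> 0"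
  shows "\<exists>m. C_k_on (Suc k) m {0..<b} \<and> m 0 = m0 \<and> (\<forall>r\<in>{0..<b}. m r > 1 \<and>
    (m has_real_derivative - mach_rate \<gamma> (m r) * (\<gamma> * m r * h r)) (at r within {0..<b}))"
proof -
  let ?S = "{0..<b}"
  define I where "I r = integral {0..r} h" for r
  define x0 where "x0 = 1 / m0"
  define K0 where "K0 = (1 - x0) * (\<gamma> + x0)"
  define K where "K r = K0 * exp ((1 - \<gamma>) * I r)" for r
  define d where "d r = (\<gamma> + 1)\<^sup>2 - 4 * K r" for r
  define x where "x r = (sqrt (d r) - (\<gamma> - 1)) / 2" for r
  have x0: "0 < x0" "x0 < 1"
    using assms by (simp_all add: x0_def)
  have K0: "0 < K0" "K0 < \<gamma>"
  proof -
    show "0 < K0"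
      unfolding K0_def using x0 assms by (intro mult_pos_pos) auto
    have "K0 = \<gamma> - (\<gamma> - 1) * x0 - x0 * x0"
      unfolding K0_def by algebra
    moreover have "(\<gamma> - 1) * x0 > 0" "x0 * x0 > 0"
      using x0 assms by (auto intro: mult_pos_pos)
    ultimately show "K0 < \<gamma>" by simp
  qed
  have dI: "(I has_real_derivative h r) (at r within ?S)" if "r \<in> ?S" for r
    unfolding I_def
    using integral_from_axis_has_derivative[OF C_k_on_continuous[OF h] that] .
  have I0: "I r \<ge> 0" if "r \<in> ?S" for r
  proof -
    have "continuous_on {0..r} h"
      using C_k_on_continuous[OF h] by (rule continuous_on_subset) (use that in auto)
    then show ?thesis
      unfolding I_def using h0 that
      by (intro integral_nonneg integrable_continuous_interval) auto
  qed
  have K: "0 < K r" "K r < \<gamma>" if "r \<in> ?S" for r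
  proof -
    show "0 < K r" using K0 by (simp add: K_def)
    have "K r \<le> K0 * 1"
      unfolding K_def using K0 I0[OF that] assms
      by (intro mult_left_mono) (auto simp: mult_nonpos_nonneg)
    then show "K r < \<gamma>" using K0 by simp
  qed
  have d: "(\<gamma> - 1)\<^sup>2 < d r" "d r < (\<gamma> + 1)\<^sup>2" "0 < d r" if "r \<in> ?S" for r
  proof -
    show *: "(\<gamma> - 1)\<^sup>2 < d r" "d r < (\<gamma> + 1)\<^sup>2"
      using K[OF that] by (simp_all add: d_def power2_eq_square algebra_simps)
    then show "0 < d r" using zero_le_power2[of "\<gamma> - 1"] by linarith
  qed
  have x: "0 < x r" "x r < 1" if "r \<in> ?S" for r
    using real_less_rsqrt[OF d(1)[OF that]] real_less_lsqrt[OF _ d(2)[OF that]] assms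
      d(3)[OF that]
    by (simp_all add: x_def)
  have sqrt_d: "sqrt (d r) = 2 * x r + (\<gamma> - 1)" for r
    unfolding x_def by (simp add: field_simps)
  have K_x: "K r = (1 - x r) * (\<gamma> + x r)" if "r \<in> ?S" for r
  proof -
    have "(2 * x r + (\<gamma> - 1))\<^sup>2 = d r"
      using d(3)[OF that] unfolding sqrt_d[symmetric] by simp
    then show ?thesis
      unfolding d_def by (simp add: power2_eq_square algebra_simps)
  qed
  have "(I has_real_derivative h r) (at r within ?S)" if "r \<in> ?S" for r
    using dI that .
  then have "C_k_on (Suc k) I ?S"
    using h by (rule C_k_on_SucI)
  then have "C_k_on (Suc k) x ?S"
    unfolding x_def[abs_def] d_def[abs_def, symmetric]
    unfolding d_def K_def using d(3)[unfolded d_def K_def]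
    by (intro C_k_on_divide C_k_on_diff C_k_on_sqrt C_k_on_mult C_k_on_exp C_k_on_const) auto
  then have "C_k_on (Suc k) (\<lambda>r. inverse (x r)) ?S"
    by (rule C_k_on_inverse) (use x in force)
  moreover have "inverse (x 0) = m0"
  proof -
    have "d 0 = (2 * x0 + (\<gamma> - 1))\<^sup>2"
      unfolding d_def K_def K0_def I_def by (simp add: power2_eq_square algebra_simps)
    then have "x 0 = x0"
      using x0 assms by (simp add: x_def)
    then show ?thesis using assms by (simp add: x0_def)
  qed
  moreover have "inverse (x r) > 1" if "r \<in> ?S" for r
    using x[OF that] by (simp add: one_less_inverse)
  moreover have "((\<lambda>r. inverse (x r)) has_real_derivative
      - mach_rate \<gamma> (inverse (x r)) * (\<gamma> * inverse (x r) * h r)) (at r within ?S)" if r: "r \<in> ?S" for r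
  proof -
    have "(K has_real_derivative K r * ((1 - \<gamma>) * h r)) (at r within ?S)"
      unfolding K_def by (auto intro!: derivative_eq_intros dI r)
    then have "(x has_real_derivative (\<gamma> - 1) * K r * h r / sqrt (d r)) (at r within ?S)"
      unfolding x_def d_def using d(3)[OF r, unfolded d_def]
      by (auto intro!: derivative_eq_intros simp: field_simps)
    then have "((\<lambda>r. inverse (x r)) has_real_derivative
        - (inverse (x r) * ((\<gamma> - 1) * K r * h r / sqrt (d r)) * inverse (x r))) (at r within ?S)"
      by (rule DERIV_inverse') (use x[OF r] in simp)
    moreover have "inverse (x r) * ((\<gamma> - 1) * K r * h r / sqrt (d r)) * inverse (x r) =
        mach_rate \<gamma> (inverse (x r)) * (\<gamma> * inverse (x r) * h r)"
    proof -
      have s: "2 * x r + (\<gamma> - 1) > 0"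
        using x[OF r] assms by simp
      have n: "x r \<noteq> 0" "\<gamma> \<noteq> 0"
        using x[OF r] assms by auto
      have "(\<gamma> - 1) * inverse (x r) + 2 = (2 * x r + (\<gamma> - 1)) / x r"
        "inverse (x r) - 1 = (1 - x r) / x r" "\<gamma> * inverse (x r) + 1 = (\<gamma> + x r) / x r"
        using n by (simp_all add: field_simps)
      then have "mach_rate \<gamma> (inverse (x r)) =
          (\<gamma> - 1) * ((1 - x r) / x r * ((\<gamma> + x r) / x r)) / (\<gamma> * ((2 * x r + (\<gamma> - 1)) / x r))"
        by (simp only: mach_rate_def)
      moreover have "inverse y * (a * (u * v) * c / e) * inverse y =
          a * (u / y * (v / y)) / (g * (e / y)) * (g * inverse y * c)"
        if "y \<noteq> 0" "e \<noteq> 0" "g \<noteq> 0" for y a u v c e g :: real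
        using that by (simp add: field_simps)
      ultimately show ?thesis
        unfolding K_x[OF r] sqrt_d using n s by (metis less_irrefl)
    qed
    ultimately show ?thesis by simp
  qed
  ultimately show ?thesis
    by (intro exI[of _ "\<lambda>r. inverse (x r)"]) simp
qed

text \<open>
  The solution is \<open>m = N\<^sup>-\<^sup>1 (N(m0) + ln (p a) - ln p)\<close>. Its regularity comes from
  the equation: if \<open>m\<close> is of class \<open>C\<^sup>j\<close> with \<open>j \<le> k\<close>, then so is its derivative.
\<close>

lemma mach_ode_given_pressure:
  fixes p p' :: "real \<Rightarrow> real"
  assumes "\<gamma> > 1" "m0 > 1" and p: "C_k_on k p S" "\<And>r. r \<in> S \<Longrightarrow> p r > 0"
    and dp: "\<And>r. r \<in> S \<Longrightarrow> (p has_real_derivative p' r) (at r within S)" and p': "C_k_on k p' S"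
  shows "\<exists>m. C_k_on (Suc k) m S \<and> m a = m0 \<and> (\<forall>r\<in>S. m r > 1 \<and>
    (m has_real_derivative - mach_rate \<gamma> (m r) * (p' r / p r)) (at r within S))"
proof -
  obtain g where g: "\<And>y. g y > 1" "\<And>m. m > 1 \<Longrightarrow> g (mach_potential \<gamma> m) = m"
    "\<And>y. (g has_real_derivative mach_rate \<gamma> (g y)) (at y)"
    using mach_potential_inverse[OF assms(1)] by metis
  define m where "m r = g (mach_potential \<gamma> m0 + ln (p a) - ln (p r))" for r
  have dm: "(m has_real_derivative - mach_rate \<gamma> (m r) * (p' r / p r)) (at r within S)" if r: "r \<in> S" for r
  proof -
    have "((\<lambda>r. mach_potential \<gamma> m0 + ln (p a) - ln (p r)) has_real_derivative - (p' r / p r)) (at r within S)"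
      using p(2)[OF r] by (auto intro!: derivative_eq_intros dp[OF r])
    from DERIV_chain2[OF g(3) this] show ?thesis
      unfolding m_def by simp
  qed
  have "C_k_on (Suc k) m S"
  proof -
    have "C_k_on j m S" if "j \<le> Suc k" for j
      using that
    proof (induction j)
      case 0
      then show ?case
        unfolding C_k_on_0
        by (intro DERIV_continuous_on[where D = "\<lambda>r. - mach_rate \<gamma> (m r) * (p' r / p r)"] dm)
    next
      case (Suc j)
      then have j: "C_k_on j m S" "j \<le> k" by auto
      have "C_k_on j (\<lambda>r. (- 1) * mach_rate \<gamma> (m r) * (p' r / p r)) S"
      proof (intro C_k_on_mult C_k_on_divide C_k_on_const C_k_on_mach_rate)
        show "m r > 0" for r unfolding m_def using g(1) less_trans[OF zero_less_one] by blast
        show "p r \<noteq> 0" if "r \<in> S" for r using p(2)[OF that] by simp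
      qed (use assms(1) j p(1) p' C_k_on_le in auto)
      then show ?case
        using dm by (intro C_k_on_SucI[where g = "\<lambda>r. (- 1) * mach_rate \<gamma> (m r) * (p' r / p r)"]) auto
    qed
    then show ?thesis by simp
  qed
  moreover have "m a = m0"
    using g(2) assms(2) by (simp add: m_def)
  moreover have "m r > 1" for r
    using g(1) by (simp add: m_def)
  ultimately show ?thesis
    using dm by (intro exI[of _ m]) simp
qed

section \<open>Uniqueness of the flow ahead of the front\<close>

text \<open>
  The Mach number is found first: its equation does not contain the pressure, in view of
  \<open>gas_speed_relation\<close>. It then determines the pressure by \<open>(ln p)' = \<gamma> m w\<^sup>2 / (r q\<^sup>2)\<close>,
  and the density and the entropy algebraically.
\<close>

lemma unique_given_swirl_speed:
  assumes "\<gamma> > 1" "A > 0" "cv > 0"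
    and U: "special_shock_solution \<gamma> A cv L r0 U U' \<phi>"
    and V: "special_shock_solution \<gamma> A cv L r0 V V' \<psi>"
    and wq: "\<And>r. r \<in> {0..<r0} \<Longrightarrow> swirl (V r) = swirl (U r) \<and> speed (V r) = speed (U r)"
    and "mach_sq \<gamma> A cv (V 0) = mach_sq \<gamma> A cv (U 0)" "pressure (V 0) = pressure (U 0)"
    and r: "r \<in> {0..<r0}"
  shows "V r = U r"
proof -
  define h where "h r = (swirl (U r))\<^sup>2 / (r * (speed (U r))\<^sup>2)" for r
  let ?m = "\<lambda>W r. mach_sq \<gamma> A cv (W r)"
  have sol: "continuous_on {0..<r0} (?m W)"
    "\<And>r. r \<in> {0..<r0} \<Longrightarrow> ?m W r > 1"
    "\<And>r. r \<in> {0<..<r0} \<Longrightarrow>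
      (?m W has_real_derivative - (\<gamma> * h r) / inverse (?m W r * mach_rate \<gamma> (?m W r))) (at r)"
    "continuous_on {0..<r0} (\<lambda>r. ln (pressure (W r)))"
    "\<And>r. r \<in> {0<..<r0} \<Longrightarrow>
      ((\<lambda>r. ln (pressure (W r))) has_real_derivative \<gamma> * ?m W r * h r) (at r)"
    if W: "special_shock_solution \<gamma> A cv L r0 W W' \<eta>"
      and eq: "\<And>r. r \<in> {0..<r0} \<Longrightarrow> swirl (W r) = swirl (U r) \<and> speed (W r) = speed (U r)" for W W' \<eta>
  proof -
    note sol = special_shock_solutionD[OF assms(1-3) W]
    note profile = swirl_profileD[OF sol(1)]
    show "continuous_on {0..<r0} (?m W)"
      using C_k_on_continuous[OF C_k_on_mach_sq[OF assms(1,2) sol(1)]] .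
    show "\<And>r. r \<in> {0..<r0} \<Longrightarrow> ?m W r > 1" using sol(3) .
    show "continuous_on {0..<r0} (\<lambda>r. ln (pressure (W r)))"
      by (rule C_k_on_continuous[OF C_k_on_ln[OF profile(1,6)]])
    fix r assume r: "r \<in> {0<..<r0}"
    then have r': "r \<in> {0..<r0}" by simp
    have "1 / r * \<rho>_of \<gamma> A cv (W r) * (swirl (W r))\<^sup>2 / pressure (W r) = \<gamma> * ?m W r * h r"
      unfolding gas_speed_relation[OF assms(1,2) profile(6,7)[OF r']] h_def
      using eq[OF r'] profile(6)[OF r'] by simp
    then show "(?m W has_real_derivative - (\<gamma> * h r) / inverse (?m W r * mach_rate \<gamma> (?m W r))) (at r)"
      "((\<lambda>r. ln (pressure (W r))) has_real_derivative \<gamma> * ?m W r * h r) (at r)"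
      using sol(5)[OF r] DERIV_chain2[OF DERIV_ln[OF profile(6)[OF r']] sol(2)[OF r]]
      by (simp_all add: mult_ac divide_inverse)
  qed
  note solU = sol[OF U] and solV = sol[OF V wq]
  note dU = special_shock_solutionD[OF assms(1-3) U] and dV = special_shock_solutionD[OF assms(1-3) V]
  have m: "?m V r = ?m U r" if "r \<in> {0..<r0}" for r
    by (rule eq_of_same_potential_rate[OF swirl_potential_deriv[OF assms(1)] _
          solV(1-3) solU(1-3) assms(7) that])
      (use mach_rate_pos[OF assms(1)] in auto)
  have "ln (pressure (V r)) = ln (pressure (U r))"
    by (rule eq_on_if_same_derivative[OF solV(4) solU(4) _ _ solU(5) r])
      (use solV(5) m assms(8) in auto)
  then have p: "pressure (V r) = pressure (U r)"
    using swirl_profileD(6)[OF dU(1) r] swirl_profileD(6)[OF dV(1) r] by simp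
  have "\<rho>_of \<gamma> A cv (V r) = \<rho>_of \<gamma> A cv (U r)"
    using gas_speed_relation[OF assms(1,2)] swirl_profileD(6,7)[OF dU(1) r]
      swirl_profileD(6,7)[OF dV(1) r] p m[OF r] wq[OF r] by simp
  then have "entropy (V r) = entropy (U r)"
    using gas_density_eq_iff[OF assms(1-3) swirl_profileD(6)[OF dU(1) r]]
      gas_density_pos[OF assms(1,2) swirl_profileD(6)[OF dU(1) r]] p
    unfolding \<rho>_of_def by metis
  then show ?thesis
    using p wq[OF r] swirl_profileD(5)[OF dU(1) r] swirl_profileD(5)[OF dV(1) r] by simp
qed

text \<open>
  The alternative may depend on \<open>r\<close>: the balance equation fixes the square of the swirl at
  each \<open>r > 0\<close>, and continuity at the axis. The speed follows from the Mach number, which the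
  pressure and the value at the axis determine.
\<close>

lemma unique_given_pressure_entropy:
  assumes "\<gamma> > 1" "A > 0" "cv > 0"
    and U: "special_shock_solution \<gamma> A cv L r0 U U' \<phi>"
    and V: "special_shock_solution \<gamma> A cv L r0 V V' \<psi>"
    and ps: "\<And>r. r \<in> {0..<r0} \<Longrightarrow> pressure (V r) = pressure (U r) \<and> entropy (V r) = entropy (U r)"
    and "speed (V 0) = speed (U 0)" and r: "r \<in> {0..<r0}"
  shows "V r = U r \<or> V r = reverse_swirl (U r)"
proof -
  let ?S = "{0..<r0}"
  let ?m = "\<lambda>W r. mach_sq \<gamma> A cv (W r)"
  note dU = special_shock_solutionD[OF assms(1-3) U] and dV = special_shock_solutionD[OF assms(1-3) V]
  note U' = swirl_profileD[OF dU(1)] and V' = swirl_profileD[OF dV(1)]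
  have \<rho>: "\<rho>_of \<gamma> A cv (V r) = \<rho>_of \<gamma> A cv (U r)" if "r \<in> ?S" for r
    using ps[OF that] by (simp add: \<rho>_of_def)
  have \<rho>_pos: "\<rho>_of \<gamma> A cv (U r) > 0" if "r \<in> ?S" for r
    using gas_density_pos[OF assms(1,2) U'(6)[OF that]] by (simp add: \<rho>_of_def)
  have w_off_axis: "(swirl (V r))\<^sup>2 = (swirl (U r))\<^sup>2" if r: "r \<in> {0<..<r0}" for r
  proof -
    have r': "r \<in> ?S" using r by simp
    have "((\<lambda>r. pressure (U r)) has_real_derivative
        (1 / r * \<rho>_of \<gamma> A cv (V r) * (swirl (V r))\<^sup>2)) (at r)"
      by (rule has_field_derivative_transform_within_open[OF dV(2)[OF r], of "{0<..<r0}"])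
        (use r ps in auto)
    from DERIV_unique[OF this dU(2)[OF r]] show ?thesis
      using \<rho>[OF r'] \<rho>_pos[OF r'] r by simp
  qed
  (* The balance says nothing at r = 0; there the squares agree as limits from the interior. *)
  have w: "(swirl (V r))\<^sup>2 = (swirl (U r))\<^sup>2"
  proof (cases "r = 0")
    case True
    have c: "continuous_on {0..<r0} (\<lambda>r. (swirl (V r))\<^sup>2 - (swirl (U r))\<^sup>2)"
      by (intro C_k_on_continuous[of 7] C_k_on_diff C_k_on_power U' V')
    have "r0 > 0" using r by simp
    have "((\<lambda>r. (swirl (V r))\<^sup>2 - (swirl (U r))\<^sup>2) \<longlongrightarrow> (swirl (V 0))\<^sup>2 - (swirl (U 0))\<^sup>2)
        (at 0 within {0..<r0})"
      using c \<open>r0 > 0\<close> unfolding continuous_on_def by auto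
    moreover have "((\<lambda>r. (swirl (V r))\<^sup>2 - (swirl (U r))\<^sup>2) \<longlongrightarrow> 0) (at 0 within {0..<r0})"
      by (rule tendsto_eventually) (use w_off_axis in \<open>auto simp: eventually_at_filter\<close>)
    moreover have "at (0::real) within {0..<r0} \<noteq> bot"
    proof -
      have "0 islimpt {0..<r0}"
        using \<open>r0 > 0\<close> islimpt_Icc[of 0 "r0 / 2" 0] islimpt_subset[of 0 "{0..r0/2}" "{0..<r0}"]
        by auto
      then show ?thesis using trivial_limit_within by blast
    qed
    ultimately show ?thesis
      using tendsto_unique True by fastforce
  next
    case False
    then show ?thesis using w_off_axis r by simp
  qed
  let ?d = "\<lambda>r. - (1 / r * \<rho>_of \<gamma> A cv (U r) * (swirl (U r))\<^sup>2 / pressure (U r))"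
  have m: "?m V r = ?m U r"
  proof (rule eq_of_same_potential_rate[OF mach_potential_deriv[OF assms(1)],
        where m = "?m V" and n = "?m U" and b = r0 and d = ?d])
    show "continuous_on ?S (?m V)" "continuous_on ?S (?m U)"
      using C_k_on_continuous[OF C_k_on_mach_sq[OF assms(1,2)]] dU(1) dV(1) by auto
    show "?m V 0 = ?m U 0"
      using mach_sq_eq[OF assms(1,2)] U'(6)[of 0] V'(6)[of 0] \<rho>[of 0] ps[of 0] assms(7) r by simp
    fix r assume r: "r \<in> {0<..<r0}"
    then have r': "r \<in> ?S" by simp
    show "(?m U has_real_derivative ?d r / inverse (mach_rate \<gamma> (?m U r))) (at r)"
      using dU(5)[OF r] by (simp add: divide_inverse mult_ac)
    show "(?m V has_real_derivative ?d r / inverse (mach_rate \<gamma> (?m V r))) (at r)"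
      using dV(5)[OF r] ps[OF r'] \<rho>[OF r'] w_off_axis[OF r] by (simp add: divide_inverse mult_ac)
  qed (use mach_rate_pos[OF assms(1)] dU(3) dV(3) r in auto)
  have "(speed (V r))\<^sup>2 = (speed (U r))\<^sup>2"
    using m mach_sq_eq[OF assms(1,2)] U'(6)[OF r] V'(6)[OF r] \<rho>[OF r] \<rho>_pos[OF r] ps[OF r] assms(1)
    by simp
  then have "speed (V r) = speed (U r)"
    using U'(7)[OF r] V'(7)[OF r] by (simp add: power2_eq_iff)
  moreover have "swirl (V r) = swirl (U r) \<or> swirl (V r) = - swirl (U r)"
    using w by (simp add: power2_eq_iff)
  ultimately show ?thesis
    using ps[OF r] U'(5)[OF r] V'(5)[OF r] unfolding reverse_swirl_def by auto
qed

section \<open>Existence of the flow ahead of the front\<close>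

text \<open>
  As long as \<open>p > 0\<close> the density is positive and \<open>p\<close> is nondecreasing, so \<open>p\<close> never
  falls below \<open>p 0\<close>. The argument looks at the first point with
  \<open>p \<le> 0\<close> because the value of
  \<open>gas_density\<close> is unspecified for \<open>p \<le> 0\<close>.
\<close>

lemma pressure_pos_of_balance:
  assumes "\<gamma> > 1" "A > 0" and cont: "continuous_on {0..<b} p"
    and bal: "radial_balance \<gamma> A cv b p w s" and "p 0 > 0" and r: "r \<in> {0..<b}"
  shows "p r > 0"
proof (rule ccontr)
  assume neg: "\<not> p r > 0"
  define Z where "Z = {0..r} \<inter> p -` {..0}"
  define c where "c = Inf Z"
  have "continuous_on {0..r} p"
    using cont by (rule continuous_on_subset) (use r in auto)
  then have "closed Z"
    unfolding Z_def by (intro continuous_closed_preimage) auto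
  moreover have "r \<in> Z" "bdd_below Z"
    using neg r by (auto simp: Z_def intro: bdd_belowI[of _ 0])
  ultimately have "c \<in> Z" and lower: "\<And>x. x \<in> Z \<Longrightarrow> c \<le> x"
    unfolding c_def using closed_contains_Inf cInf_lower by auto
  then have c: "0 \<le> c" "c \<le> r" "p c \<le> 0" by (auto simp: Z_def)
  (* c is the first point with p c \<le> 0. *)
  have "p 0 \<le> p c"
  proof (rule DERIV_nonneg_imp_increasing_open[OF c(1)])
    show "continuous_on {0..c} p"
      using cont by (rule continuous_on_subset) (use r c in auto)
    fix x assume x: "0 < x" "x < c"
    then have "x \<notin> Z" using lower by force
    then have "p x > 0" using x c by (auto simp: Z_def)
    then have "gas_density \<gamma> A cv (p x) (s x) > 0"
      using gas_density_pos assms(1,2) by simp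
    then have "1 / x * gas_density \<gamma> A cv (p x) (s x) * (w x)\<^sup>2 \<ge> 0"
      using x by (intro mult_nonneg_nonneg) auto
    moreover have "x \<in> {0<..<b}" using x c r by auto
    ultimately show "\<exists>y. (p has_real_derivative y) (at x) \<and> 0 \<le> y"
      using bal unfolding radial_balance_def by blast
  qed
  then show False using c(3) assms(5) by simp
qed

lemma exists_given_swirl_speed:
  assumes "\<gamma> > 1" "A > 0" "cv > 0" "r0 > 0"
    and w: "C_k_on 7 w {0..<r0}" "w 0 = 0"
    and q: "C_k_on 7 q {0..<r0}" "\<And>r. r \<in> {0..<r0} \<Longrightarrow> q r > 0"
    and "M0 > 1" "p0 > 0"
  shows "\<exists>U. data_swirl_speed \<gamma> A cv r0 w q M0 p0 U \<and>
    (\<forall>zs\<in>{0<..<L}. special_shock_solution \<gamma> A cv L r0 U (\<lambda>r. post_shock \<gamma> A cv (U r)) (\<lambda>r. zs))"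
proof -
  let ?S = "{0..<r0}"
  have seven: "7 = Suc 6" by simp
  obtain v where v: "C_k_on 6 v ?S" "\<And>r. r \<in> ?S \<Longrightarrow> w r = r * v r"
    using C_k_on_factor_axis[OF w(1)[unfolded seven] w(2)] by blast
  (* h is w\<^sup>2 / (r q\<^sup>2), extended to the axis by means of v = w / r; it vanishes
     there. *)
  define h where "h r = w r * v r / (q r)\<^sup>2" for r
  have C6: "C_k_on 6 w ?S" "C_k_on 6 q ?S"
    using w(1) q(1) C_k_on_le[of 7 _ ?S 6] by auto
  have "(q r)\<^sup>2 \<noteq> 0" if "r \<in> ?S" for r
    using q(2)[OF that] by simp
  then have C_h: "C_k_on 6 h ?S"
    unfolding h_def by (intro C_k_on_divide C_k_on_mult C_k_on_power C6 v(1)) auto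
  have h_nonneg: "h r \<ge> 0" if "r \<in> ?S" for r
    unfolding h_def v(2)[OF that] using that by (simp add: mult.assoc)
  have h_eq: "h r = (w r)\<^sup>2 / (r * (q r)\<^sup>2)" if "r \<in> {0<..<r0}" for r
    unfolding h_def using v(2)[of r] that by (simp add: power2_eq_square)
  have "M0\<^sup>2 > 1" using assms(9) by (simp add: one_less_power)
  from mach_ode_given_swirl[OF assms(1) this C_h h_nonneg]
  obtain m where m: "C_k_on 7 m ?S" "m 0 = M0\<^sup>2" "\<And>r. r \<in> ?S \<Longrightarrow> m r > 1"
    and dm: "\<And>r. r \<in> ?S \<Longrightarrow>
      (m has_real_derivative - mach_rate \<gamma> (m r) * (\<gamma> * m r * h r)) (at r within ?S)"
    by auto
  define k where "k r = \<gamma> * m r * h r" for r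
  have C_k: "C_k_on 6 k ?S"
    unfolding k_def using C_k_on_le[OF m(1), of 6] C_h
    by (intro C_k_on_mult C_k_on_const) auto
  (* The solution of p' = k p, which is the radial balance. *)
  define p where "p r = p0 * exp (integral {0..r} k)" for r
  have p_pos: "p r > 0" for r
    using assms(10) by (simp add: p_def)
  have dI: "((\<lambda>r. integral {0..r} k) has_real_derivative k r) (at r within ?S)" if "r \<in> ?S" for r
    using integral_from_axis_has_derivative[OF C_k_on_continuous[OF C_k] that] .
  have dp: "(p has_real_derivative p r * k r) (at r within ?S)" if "r \<in> ?S" for r
    unfolding p_def by (auto intro!: derivative_eq_intros dI that)
  have C_p: "C_k_on 7 p ?S"
    unfolding p_def seven
    by (intro C_k_on_mult C_k_on_exp C_k_on_const C_k_on_SucI[OF dI C_k])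
  (* The density is the one that gives the squared Mach number m, and the entropy s the one that
     gives this density. *)
  define \<rho> where "\<rho> r = \<gamma> * p r * m r / (q r)\<^sup>2" for r
  have \<rho>_pos: "\<rho> r > 0" if "r \<in> ?S" for r
    unfolding \<rho>_def using p_pos[of r] m(3)[OF that] q(2)[OF that] assms(1) by simp
  have C_\<rho>: "C_k_on 7 \<rho> ?S"
    unfolding \<rho>_def
    by (intro C_k_on_divide C_k_on_mult C_k_on_power C_k_on_const C_p m(1) q(1)) (use q(2) in force)
  define s where "s r = cv * ln (p r / (A * \<rho> r powr \<gamma>))" for r
  have C_s: "C_k_on 7 s ?S"
    unfolding s_def
  proof (rule C_k_on_mult[OF C_k_on_const C_k_on_ln[OF C_k_on_divide[OF C_p
          C_k_on_mult[OF C_k_on_const C_k_on_powr[OF C_\<rho> \<rho>_pos]]]]])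
    fix r assume "r \<in> ?S"
    then have "A * \<rho> r powr \<gamma> > 0" using \<rho>_pos[of r] assms(2) by simp
    then show "p r / (A * \<rho> r powr \<gamma>) > 0" "A * \<rho> r powr \<gamma> \<noteq> 0"
      using p_pos[of r] by (auto intro: divide_pos_pos)
  qed
  define U where "U r = \<lparr>pressure = p r, angle = 0, swirl = w r, speed = q r, entropy = s r\<rparr>" for r
  have U: "swirl_profile r0 U"
    unfolding swirl_profile_def U_def using C_p w(1) q C_s p_pos by simp
  have \<rho>_of: "\<rho>_of \<gamma> A cv (U r) = \<rho> r" if "r \<in> ?S" for r
    using gas_density_eq_iff[OF assms(1-3) p_pos \<rho>_pos[OF that], of r "s r"]
    by (simp add: \<rho>_of_def U_def s_def)
  have mach: "mach_sq \<gamma> A cv (U r) = m r" if "r \<in> ?S" for r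
    using mach_sq_eq[OF assms(1,2), of "U r"] \<rho>_of[OF that] p_pos[of r] q(2)[OF that] assms(1)
    by (simp add: U_def \<rho>_def)
  have rate: "1 / r * \<rho>_of \<gamma> A cv (U r) * (swirl (U r))\<^sup>2 = p r * k r" if "r \<in> {0<..<r0}" for r
    using that \<rho>_of[of r] by (simp add: U_def \<rho>_def k_def h_eq)
  have "special_shock_solution \<gamma> A cv L r0 U (\<lambda>r. post_shock \<gamma> A cv (U r)) (\<lambda>r. zs)"
    if "zs \<in> {0<..<L}" for zs
  proof (rule special_shock_solution_post_shock[OF assms(1-3) U _ _ _ that])
    fix r assume r: "r \<in> {0<..<r0}"
    show "((\<lambda>r. pressure (U r)) has_real_derivative
        (1 / r * \<rho>_of \<gamma> A cv (U r) * (swirl (U r))\<^sup>2)) (at r)"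
      using dp[of r] r at_within_axis[OF r] unfolding rate[OF r] by (simp add: U_def)
    have "(m has_real_derivative - mach_rate \<gamma> (m r) * k r) (at r)"
      using dm[of r] r at_within_axis[OF r] by (simp add: k_def)
    then have "((\<lambda>r. mach_sq \<gamma> A cv (U r)) has_real_derivative - mach_rate \<gamma> (m r) * k r) (at r)"
      by (rule has_field_derivative_transform_within_open[where S = "{0<..<r0}"])
        (use r mach in auto)
    then show "((\<lambda>r. mach_sq \<gamma> A cv (U r)) has_real_derivative
        - mach_rate \<gamma> (mach_sq \<gamma> A cv (U r)) *
          (1 / r * \<rho>_of \<gamma> A cv (U r) * (swirl (U r))\<^sup>2 / pressure (U r))) (at r)"
      unfolding rate[OF r] using mach[of r] r p_pos[of r] by (simp add: U_def)
  qed (use mach m(3) in auto)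
  moreover have "data_swirl_speed \<gamma> A cv r0 w q M0 p0 U"
    unfolding data_swirl_speed_def using mach[of 0] m(2) assms(4) by (simp add: U_def p_def)
  ultimately show ?thesis by blast
qed

lemma exists_given_pressure_entropy:
  assumes "\<gamma> > 1" "A > 0" "cv > 0" "r0 > 0"
    and p: "C_k_on 7 p {0..<r0}" "p 0 > 0" and s: "C_k_on 7 s {0..<r0}"
    and compat: "swirl_compatible \<gamma> A cv r0 p s"
    and q0: "q0 > 0" "q0\<^sup>2 / (\<gamma> * p 0 / gas_density \<gamma> A cv (p 0) (s 0)) > 1"
  shows "\<exists>U. data_pressure_entropy r0 p s q0 U \<and>
    (\<forall>zs\<in>{0<..<L}. special_shock_solution \<gamma> A cv L r0 U (\<lambda>r. post_shock \<gamma> A cv (U r)) (\<lambda>r. zs))"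
proof -
  let ?S = "{0..<r0}"
  have seven: "7 = Suc 6" by simp
  obtain w where w: "C_k_on 7 w ?S" and bal: "radial_balance \<gamma> A cv r0 p w s"
    using compat unfolding swirl_compatible_def by blast
  have p_pos: "p r > 0" if "r \<in> ?S" for r
    using pressure_pos_of_balance[OF assms(1,2) C_k_on_continuous[OF p(1)] bal p(2) that] .
  obtain p' where dp: "\<And>r. r \<in> ?S \<Longrightarrow> (p has_real_derivative p' r) (at r within ?S)"
    and p': "C_k_on 6 p' ?S"
    using p(1) unfolding seven C_k_on_Suc by blast
  define \<rho> where "\<rho> r = gas_density \<gamma> A cv (p r) (s r)" for r
  have \<rho>_pos: "\<rho> r > 0" if "r \<in> ?S" for r
    using gas_density_pos[OF assms(1,2) p_pos[OF that]] by (simp add: \<rho>_def)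
  have C_\<rho>: "C_k_on 7 \<rho> ?S"
    unfolding \<rho>_def by (rule C_k_on_gas_density[OF assms(1,2) p_pos p(1) s])
  define m0 where "m0 = q0\<^sup>2 * \<rho> 0 / (\<gamma> * p 0)"
  have "m0 > 1" using q0(2) by (simp add: m0_def \<rho>_def)
  moreover have "C_k_on 6 p ?S" using C_k_on_le[OF p(1)] by simp
  ultimately obtain m where m: "C_k_on 7 m ?S" "m 0 = m0" "\<And>r. r \<in> ?S \<Longrightarrow> m r > 1"
    and dm: "\<And>r. r \<in> ?S \<Longrightarrow>
      (m has_real_derivative - mach_rate \<gamma> (m r) * (p' r / p r)) (at r within ?S)"
    using mach_ode_given_pressure[OF assms(1), of m0 6 p ?S p' 0] p_pos dp p' by auto
  (* The speed at which the squared Mach number is m. *)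
  define q where "q r = sqrt (\<gamma> * p r * m r / \<rho> r)" for r
  have radicand: "\<gamma> * p r * m r / \<rho> r > 0" if "r \<in> ?S" for r
    using p_pos[OF that] m(3)[OF that] \<rho>_pos[OF that] assms(1) by simp
  have q_pos: "q r > 0" if "r \<in> ?S" for r
    using radicand[OF that] by (simp add: q_def)
  have C_q: "C_k_on 7 q ?S"
    unfolding q_def
    by (rule C_k_on_sqrt[OF C_k_on_divide[OF C_k_on_mult[OF C_k_on_mult[OF C_k_on_const p(1)] m(1)] C_\<rho>]
          radicand]) (use \<rho>_pos in force)
  define U where "U r = \<lparr>pressure = p r, angle = 0, swirl = w r, speed = q r, entropy = s r\<rparr>" for r
  have U: "swirl_profile r0 U"
    unfolding swirl_profile_def U_def using p(1) w s C_q p_pos q_pos by simp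
  have \<rho>_of: "\<rho>_of \<gamma> A cv (U r) = \<rho> r" for r
    by (simp add: \<rho>_of_def U_def \<rho>_def)
  have mach: "mach_sq \<gamma> A cv (U r) = m r" if "r \<in> ?S" for r
    using mach_sq_eq[OF assms(1,2), of "U r" cv] p_pos[OF that] \<rho>_pos[OF that] radicand[OF that] assms(1)
    unfolding \<rho>_of by (simp add: U_def q_def)
  have balU: "((\<lambda>r. pressure (U r)) has_real_derivative
      (1 / r * \<rho>_of \<gamma> A cv (U r) * (swirl (U r))\<^sup>2)) (at r)" if "r \<in> {0<..<r0}" for r
    using bal that unfolding radial_balance_def \<rho>_of by (simp add: U_def \<rho>_def)
  have "special_shock_solution \<gamma> A cv L r0 U (\<lambda>r. post_shock \<gamma> A cv (U r)) (\<lambda>r. zs)"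
    if "zs \<in> {0<..<L}" for zs
  proof (rule special_shock_solution_post_shock[OF assms(1-3) U balU _ _ that])
    fix r assume r: "r \<in> {0<..<r0}"
    then have r': "r \<in> ?S" by simp
    (* p' is a derivative within the half-open interval, the balance one on both sides; off the
       axis they agree. *)
    have p'_eq: "1 / r * \<rho>_of \<gamma> A cv (U r) * (swirl (U r))\<^sup>2 = p' r"
      using DERIV_unique[OF balU[OF r]] dp[OF r'] at_within_axis[OF r] by (simp add: U_def)
    have "(m has_real_derivative - mach_rate \<gamma> (m r) * (p' r / p r)) (at r)"
      using dm[OF r'] at_within_axis[OF r] by simp
    then have "((\<lambda>r. mach_sq \<gamma> A cv (U r)) has_real_derivative
        - mach_rate \<gamma> (m r) * (p' r / p r)) (at r)"
      by (rule has_field_derivative_transform_within_open[where S = "{0<..<r0}"])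
        (use r mach in auto)
    then show "((\<lambda>r. mach_sq \<gamma> A cv (U r)) has_real_derivative
        - mach_rate \<gamma> (mach_sq \<gamma> A cv (U r)) *
          (1 / r * \<rho>_of \<gamma> A cv (U r) * (swirl (U r))\<^sup>2 / pressure (U r))) (at r)"
      unfolding p'_eq using mach[OF r'] by (simp add: U_def)
  qed (use mach m(3) in auto)
  moreover have "data_pressure_entropy r0 p s q0 U"
  proof -
    have "q 0 = q0"
      using m(2) \<rho>_pos[of 0] p(2) q0(1) assms(1,4) by (simp add: q_def m0_def)
    then show ?thesis
      unfolding data_pressure_entropy_def by (simp add: U_def)
  qed
  ultimately show ?thesis by blast
qed

section \<open>Special shock solutions\<close>

theorem theorem2p2:
  fixes \<gamma> A cv L r0 :: real
  assumes "\<gamma> > 1" and "A > 0" and "cv > 0" and "L > 0" and "r0 > 0"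
  shows
    "(\<forall>w q :: real \<Rightarrow> real. \<forall>M0 p0 :: real.
        C_k_on 7 w {0..<r0} \<and> C_k_on 7 q {0..<r0} \<and>
        w 0 = 0 \<and> (\<forall>r\<in>{0..<r0}. q r > 0) \<and> M0 > 1 \<and> p0 > 0 \<longrightarrow>
        (\<exists>Um Up.
           data_swirl_speed \<gamma> A cv r0 w q M0 p0 Um \<and>
           (\<forall>zs\<in>{0<..<L}. special_shock_solution \<gamma> A cv L r0 Um Up (\<lambda>r. zs)) \<and>
           (\<forall>Vm Vp \<psi>.
              special_shock_solution \<gamma> A cv L r0 Vm Vp \<psi> \<and>
              data_swirl_speed \<gamma> A cv r0 w q M0 p0 Vm \<longrightarrow>
              (\<exists>zs\<in>{0<..<L}. \<forall>r\<in>{0..<r0}. \<psi> r = zs \<and> Vm r = Um r \<and> Vp r = Up r))))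
     \<and>
     (\<forall>p s :: real \<Rightarrow> real. \<forall>q0 :: real.
        C_k_on 7 p {0..<r0} \<and> C_k_on 7 s {0..<r0} \<and> swirl_compatible \<gamma> A cv r0 p s \<and>
        p 0 > 0 \<and> q0 > 0 \<and> q0\<^sup>2 / (\<gamma> * p 0 / gas_density \<gamma> A cv (p 0) (s 0)) > 1 \<longrightarrow>
        (\<exists>Um Up.
           data_pressure_entropy r0 p s q0 Um \<and>
           (\<forall>zs\<in>{0<..<L}. special_shock_solution \<gamma> A cv L r0 Um Up (\<lambda>r. zs)) \<and>
           (\<forall>Vm Vp \<psi>.
              special_shock_solution \<gamma> A cv L r0 Vm Vp \<psi> \<and>
              data_pressure_entropy r0 p s q0 Vm \<longrightarrow>
              (\<exists>zs\<in>{0<..<L}. \<forall>r\<in>{0..<r0}. \<psi> r = zs \<and>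
                 (Vm r = Um r \<and> Vp r = Up r \<or>
                  Vm r = reverse_swirl (Um r) \<and> Vp r = reverse_swirl (Up r))))))"
proof (intro conjI allI impI)
  fix w q :: "real \<Rightarrow> real" and M0 p0 :: real
  assume "C_k_on 7 w {0..<r0} \<and> C_k_on 7 q {0..<r0} \<and>
    w 0 = 0 \<and> (\<forall>r\<in>{0..<r0}. q r > 0) \<and> M0 > 1 \<and> p0 > 0"
  then obtain U where dataU: "data_swirl_speed \<gamma> A cv r0 w q M0 p0 U"
    and U: "\<And>zs. zs \<in> {0<..<L} \<Longrightarrow>
      special_shock_solution \<gamma> A cv L r0 U (\<lambda>r. post_shock \<gamma> A cv (U r)) (\<lambda>r. zs)"
    using exists_given_swirl_speed[OF assms(1-3,5), of w q M0 p0 L] by blast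
  (* A particular front, so that U can be compared with other solutions. *)
  have U0: "special_shock_solution \<gamma> A cv L r0 U (\<lambda>r. post_shock \<gamma> A cv (U r)) (\<lambda>r. L / 2)"
    using U assms(4) by simp
  show "\<exists>Um Up.
           data_swirl_speed \<gamma> A cv r0 w q M0 p0 Um \<and>
           (\<forall>zs\<in>{0<..<L}. special_shock_solution \<gamma> A cv L r0 Um Up (\<lambda>r. zs)) \<and>
           (\<forall>Vm Vp \<psi>.
              special_shock_solution \<gamma> A cv L r0 Vm Vp \<psi> \<and>
              data_swirl_speed \<gamma> A cv r0 w q M0 p0 Vm \<longrightarrow>
              (\<exists>zs\<in>{0<..<L}. \<forall>r\<in>{0..<r0}. \<psi> r = zs \<and> Vm r = Um r \<and> Vp r = Up r))"
  proof (intro exI conjI ballI allI impI)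
    fix Vm Vp \<psi>
    assume "special_shock_solution \<gamma> A cv L r0 Vm Vp \<psi> \<and> data_swirl_speed \<gamma> A cv r0 w q M0 p0 Vm"
    then have V: "special_shock_solution \<gamma> A cv L r0 Vm Vp \<psi>"
      and dataV: "data_swirl_speed \<gamma> A cv r0 w q M0 p0 Vm" by auto
    obtain zs where zs: "zs \<in> {0<..<L}" "\<And>r. r \<in> {0..<r0} \<Longrightarrow> \<psi> r = zs"
      using V unfolding special_shock_solution_def by blast
    have "Vm r = U r" if "r \<in> {0..<r0}" for r
      by (rule unique_given_swirl_speed[OF assms(1-3) U0 V _ _ _ that])
        (use dataU dataV in \<open>auto simp: data_swirl_speed_def\<close>)
    then show "\<exists>zs\<in>{0<..<L}. \<forall>r\<in>{0..<r0}. \<psi> r = zs \<and> Vm r = U r \<and> Vp r = post_shock \<gamma> A cv (U r)"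
      using zs special_shock_solutionD(4)[OF assms(1-3) V] by (intro bexI[of _ zs]) auto
  qed (use dataU U in auto)
next
  fix p s :: "real \<Rightarrow> real" and q0 :: real
  assume "C_k_on 7 p {0..<r0} \<and> C_k_on 7 s {0..<r0} \<and> swirl_compatible \<gamma> A cv r0 p s \<and>
    p 0 > 0 \<and> q0 > 0 \<and> q0\<^sup>2 / (\<gamma> * p 0 / gas_density \<gamma> A cv (p 0) (s 0)) > 1"
  then obtain U where dataU: "data_pressure_entropy r0 p s q0 U"
    and U: "\<And>zs. zs \<in> {0<..<L} \<Longrightarrow>
      special_shock_solution \<gamma> A cv L r0 U (\<lambda>r. post_shock \<gamma> A cv (U r)) (\<lambda>r. zs)"
    using exists_given_pressure_entropy[OF assms(1-3,5), of p s q0 L] by blast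
  have U0: "special_shock_solution \<gamma> A cv L r0 U (\<lambda>r. post_shock \<gamma> A cv (U r)) (\<lambda>r. L / 2)"
    using U assms(4) by simp
  show "\<exists>Um Up.
           data_pressure_entropy r0 p s q0 Um \<and>
           (\<forall>zs\<in>{0<..<L}. special_shock_solution \<gamma> A cv L r0 Um Up (\<lambda>r. zs)) \<and>
           (\<forall>Vm Vp \<psi>.
              special_shock_solution \<gamma> A cv L r0 Vm Vp \<psi> \<and>
              data_pressure_entropy r0 p s q0 Vm \<longrightarrow>
              (\<exists>zs\<in>{0<..<L}. \<forall>r\<in>{0..<r0}. \<psi> r = zs \<and>
                 (Vm r = Um r \<and> Vp r = Up r \<or>
                  Vm r = reverse_swirl (Um r) \<and> Vp r = reverse_swirl (Up r))))"
  proof (intro exI conjI ballI allI impI)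
    fix Vm Vp \<psi>
    assume "special_shock_solution \<gamma> A cv L r0 Vm Vp \<psi> \<and> data_pressure_entropy r0 p s q0 Vm"
    then have V: "special_shock_solution \<gamma> A cv L r0 Vm Vp \<psi>"
      and dataV: "data_pressure_entropy r0 p s q0 Vm" by auto
    obtain zs where zs: "zs \<in> {0<..<L}" "\<And>r. r \<in> {0..<r0} \<Longrightarrow> \<psi> r = zs"
      using V unfolding special_shock_solution_def by blast
    have ahead: "Vm r = U r \<or> Vm r = reverse_swirl (U r)" if "r \<in> {0..<r0}" for r
      by (rule unique_given_pressure_entropy[OF assms(1-3) U0 V _ _ that])
        (use dataU dataV in \<open>auto simp: data_pressure_entropy_def\<close>)
    have "Vm r = U r \<and> Vp r = post_shock \<gamma> A cv (U r) \<or>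
        Vm r = reverse_swirl (U r) \<and> Vp r = reverse_swirl (post_shock \<gamma> A cv (U r))"
      if "r \<in> {0..<r0}" for r
      using ahead[OF that] special_shock_solutionD(4)[OF assms(1-3) V that]
      by (auto simp flip: post_shock_reverse_swirl)
    with zs show "\<exists>zs\<in>{0<..<L}. \<forall>r\<in>{0..<r0}. \<psi> r = zs \<and>
        (Vm r = U r \<and> Vp r = post_shock \<gamma> A cv (U r) \<or>
         Vm r = reverse_swirl (U r) \<and> Vp r = reverse_swirl (post_shock \<gamma> A cv (U r)))"
      by (intro bexI[of _ zs] ballI conjI) auto
  qed (use dataU U in auto)
qed

end
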